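(* Let $A$ be a unital $\mathrm{C}^*$-algebra containing two full orthogonal projections. Let $H$ be a normal subgroup of $\mathrm{U}_A$ such that the closed two-sided ideal of $A$ generated by $[H,\mathrm{U}_A]$ is $A$. Then $(\mathrm{U}_A,\mathrm{U}_A)\subseteq H$.
   Context: $\mathrm{U}_A$ denotes the connected component of the identity (in the norm topology) of the unitary group of the unital $\mathrm{C}^*$-algebra $A$. $[H,\mathrm{U}_A]$ is the linear span of the commutators $[h,u]=hu-uh$ with $h\in H$, $u\in\mathrm{U}_A$. $(\mathrm{U}_A,\mathrm{U}_A)$ is the (algebraic, not closed) commutator subgroup, generated by the elements $uvu^{-1}v^{-1}$ with $u,v\in\mathrm{U}_A$. $H$ is not assumed closed. A projection is full if it generates $A$ as a closed two-sided ideal; projections $p,q$ are orthogonal if $pq=0$. *)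

theory Defs
  imports "HOL-Analysis.Analysis" "HOL-Algebra.Generated_Groups"
begin

text \<open>
  Nonzero unital \<open>C\<^sup>*\<close>-algebras: \<open>real_normed_algebra_1\<close> provides \<open>1 \<noteq> 0\<close> and \<open>norm 1 = 1\<close>
  (the latter also follows from the \<open>C\<^sup>*\<close>-identity once \<open>1 \<noteq> 0\<close>).
\<close>

class cstar_algebra = real_normed_algebra_1 + banach +
  fixes scaleC :: "complex \<Rightarrow> 'a \<Rightarrow> 'a" (infixr "*\<^sub>C" 75)
    and adj :: "'a \<Rightarrow> 'a"
  assumes scaleC_add_right: "c *\<^sub>C (x + y) = c *\<^sub>C x + c *\<^sub>C y"
    and scaleC_add_left: "(c + d) *\<^sub>C x = c *\<^sub>C x + d *\<^sub>C x"
    and scaleC_scaleC: "c *\<^sub>C (d *\<^sub>C x) = (c * d) *\<^sub>C x"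
    and scaleC_of_real: "complex_of_real r *\<^sub>C x = r *\<^sub>R x"
    and mult_scaleC_left: "(c *\<^sub>C x) * y = c *\<^sub>C (x * y)"
    and mult_scaleC_right: "x * (c *\<^sub>C y) = c *\<^sub>C (x * y)"
    and norm_scaleC: "norm (c *\<^sub>C x) = cmod c * norm x"
    and adj_add: "adj (x + y) = adj x + adj y"
    and adj_scaleC: "adj (c *\<^sub>C x) = cnj c *\<^sub>C adj x"
    and adj_mult: "adj (x * y) = adj y * adj x"
    and adj_adj: "adj (adj x) = x"
    and cstar_identity: "norm (adj x * x) = (norm x)\<^sup>2"

global_interpretation complex_vector:
  vector_space "scaleC :: complex \<Rightarrow> 'a \<Rightarrow> 'a::cstar_algebra"
  defines csubspace = complex_vector.subspace
    and cspan = complex_vector.span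
proof
  show "1 *\<^sub>C x = x" for x :: 'a
    using scaleC_of_real[of 1 x] by simp
qed (simp_all add: scaleC_add_right scaleC_add_left scaleC_scaleC)

definition closed_ideal :: "'a::cstar_algebra set \<Rightarrow> bool" where
  "closed_ideal I \<longleftrightarrow>
     csubspace I \<and> (\<forall>a. \<forall>x\<in>I. a * x \<in> I \<and> x * a \<in> I) \<and> closed I"

abbreviation closed_ideal_generated :: "'a::cstar_algebra set \<Rightarrow> 'a set" where
  "closed_ideal_generated S \<equiv> closed_ideal hull S"

definition projection :: "'a::cstar_algebra \<Rightarrow> bool" where
  "projection p \<longleftrightarrow> p * p = p \<and> adj p = p"

definition full_projection :: "'a::cstar_algebra \<Rightarrow> bool" where
  "full_projection p \<longleftrightarrow> projection p \<and> closed_ideal_generated {p} = UNIV"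

definition commutator_span :: "'a::cstar_algebra set \<Rightarrow> 'a set \<Rightarrow> 'a set" where
  "commutator_span S T = cspan {s * t - t * s | s t. s \<in> S \<and> t \<in> T}"

definition unitaries :: "'a::cstar_algebra set" where
  "unitaries = {u. adj u * u = 1 \<and> u * adj u = 1}"

definition unitary_component :: "'a::cstar_algebra set" where
  "unitary_component = connected_component_set unitaries 1"

definition U_group :: "'a::cstar_algebra monoid" where
  "U_group = \<lparr>carrier = unitary_component, monoid.mult = (*), one = 1\<rparr>"

lemma closed_ideal_hull: "closed_ideal (closed_ideal hull S)"
proof (rule hull_in)
  fix T :: "'a set set"
  assume T: "Ball T closed_ideal"
  have "csubspace (\<Inter>T)"
    using T by (intro complex_vector.subspace_Inter) (auto simp: closed_ideal_def)
  then show "closed_ideal (\<Inter>T)"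
    using T by (auto simp: closed_ideal_def)
qed

lemma adj_one [simp]: "adj 1 = (1 :: 'a::cstar_algebra)"
  by (metis adj_adj adj_mult mult_1_left mult_1_right)

lemma norm_adj [simp]: "norm (adj x) = norm (x :: 'a::cstar_algebra)"
proof -
  have le: "norm y \<le> norm (adj y)" for y :: 'a
  proof (cases "norm y = 0")
    case False
    have "norm y * norm y \<le> norm (adj y) * norm y"
      using cstar_identity[of y] norm_mult_ineq[of "adj y" y]
      by (simp add: power2_eq_square)
    then show ?thesis
      using False by (simp add: mult_le_cancel_right)
  qed simp
  show ?thesis
    using le[of x] le[of "adj x"] by (simp add: adj_adj)
qed

lemma adj_scaleR: "adj (r *\<^sub>R x) = r *\<^sub>R adj (x :: 'a::cstar_algebra)"
  using adj_scaleC[of "complex_of_real r" x] by (simp add: scaleC_of_real)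

lemma bounded_linear_adj: "bounded_linear (adj :: 'a::cstar_algebra \<Rightarrow> 'a)"
  by (rule bounded_linear_intro[where K = 1]) (simp_all add: adj_add adj_scaleR)

lemma one_in_unitaries [simp]: "1 \<in> (unitaries :: 'a::cstar_algebra set)"
  by (simp add: unitaries_def)

lemma unitaries_mult:
  assumes "u \<in> unitaries" "v \<in> unitaries"
  shows "u * v \<in> (unitaries :: 'a::cstar_algebra set)"
proof -
  have "adj v * (adj u * u) * v = 1" "u * (v * adj v) * adj u = 1"
    using assms by (auto simp: unitaries_def)
  then show ?thesis
    by (simp add: unitaries_def adj_mult mult.assoc)
qed

lemma unitaries_adj: "u \<in> unitaries \<Longrightarrow> adj u \<in> (unitaries :: 'a::cstar_algebra set)"
  by (simp add: unitaries_def adj_adj)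

lemma unitary_component_mult:
  assumes "u \<in> unitary_component" "v \<in> unitary_component"
  shows "u * v \<in> (unitary_component :: 'a::cstar_algebra set)"
proof -
  obtain S T where S: "connected S" "S \<subseteq> unitaries" "1 \<in> S" "u \<in> S"
    and T: "connected T" "T \<subseteq> unitaries" "1 \<in> T" "v \<in> T"
    using assms unfolding unitary_component_def connected_component_def by auto
  define W where "W = (\<lambda>(x, y). x * y) ` (S \<times> T)"
  have "connected W"
    unfolding W_def case_prod_unfold
    by (intro connected_continuous_image connected_Times S T continuous_intros)
  moreover have "W \<subseteq> unitaries"
    using S T by (auto simp: W_def intro!: unitaries_mult)
  moreover have "1 \<in> W" "u * v \<in> W"
    using S T by (force simp: W_def)+
  ultimately show ?thesis
    unfolding unitary_component_def connected_component_def by blast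
qed

lemma unitary_component_adj:
  assumes "u \<in> unitary_component"
  shows "adj u \<in> (unitary_component :: 'a::cstar_algebra set)"
proof -
  obtain S where S: "connected S" "S \<subseteq> unitaries" "1 \<in> S" "u \<in> S"
    using assms unfolding unitary_component_def connected_component_def by auto
  have "connected (adj ` S)"
    by (intro connected_continuous_image S linear_continuous_on bounded_linear_adj)
  moreover have "adj ` S \<subseteq> unitaries" "1 \<in> adj ` S" "adj u \<in> adj ` S"
    using S unitaries_adj image_eqI[of 1 adj 1 S] by auto
  ultimately show ?thesis
    unfolding unitary_component_def connected_component_def by blast
qed

lemma unitary_component_subset: "unitary_component \<subseteq> (unitaries :: 'a::cstar_algebra set)"
  by (simp add: unitary_component_def connected_component_subset)

lemma group_U_group: "group (U_group :: 'a::cstar_algebra monoid)"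
proof (rule groupI)
  show "\<exists>y\<in>carrier U_group. y \<otimes>\<^bsub>U_group\<^esub> x = \<one>\<^bsub>U_group\<^esub>"
    if "x \<in> carrier U_group" for x :: 'a
    using that unitary_component_adj[of x] unitary_component_subset
    by (auto simp: U_group_def unitaries_def)
next
  show "\<one>\<^bsub>U_group\<^esub> \<in> carrier (U_group :: 'a monoid)"
    by (simp add: U_group_def unitary_component_def)
qed (auto simp: U_group_def unitary_component_mult mult.assoc)

lemma inv_U_group:
  assumes "u \<in> unitary_component"
  shows "inv\<^bsub>U_group\<^esub> u = adj (u :: 'a::cstar_algebra)"
  using assms unitary_component_adj[of u] unitary_component_subset
  by (intro group.inv_equality[OF group_U_group]) (auto simp: U_group_def unitaries_def)

end

theory Submission imports Defs begin

text \<open>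
  The commutator subgroup is reached by showing that the unitaries of a corner represent all unitaries
  modulo \<open>H\<close>. Write \<open>A\<close> for the algebra and \<open>U\<close> for the connected group of unitaries. If \<open>p\<close> and \<open>q\<close> are
  orthogonal full projections, then every element of \<open>U\<close> is \<open>h v\<close> with \<open>h\<close> in \<open>H\<close> and \<open>v\<close> in the corner of
  \<open>p\<close>, and also \<open>h' v'\<close> with \<open>v'\<close> in the corner of \<open>q\<close>. Elements of the two corners commute, so \<open>U\<close> is
  commutative modulo \<open>H\<close> (\<open>commutator_mem\<close>). Three steps lead to this decomposition.

  The linear span of \<open>H\<close> is dense in \<open>A\<close> (\<open>closure_cspan_eq_UNIV\<close>). Its closure is a closed subalgebra,
  invariant under conjugation by \<open>U\<close>, and by differentiating the conjugations it is a Lie ideal. Herstein's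
  argument puts into it the closed ideal generated by the commutators of elements of \<open>H\<close> with elements
  of \<open>A\<close>, and this ideal is \<open>A\<close> by hypothesis.

  The subgroup \<open>H\<close> contains \<open>exp K\<close> for every skew-adjoint \<open>K\<close> that is off-diagonal with respect to
  some projection (\<open>exp_off_diagonal_mem\<close>). To first order, \<open>H\<close> contains the real span of the elements
  \<open>h V h\<^sup>* - V\<close> with \<open>V\<close> skew-adjoint, and by density these approximate the skew-adjoint parts of all
  commutators. Off-diagonal elements are commutators with the symmetry \<open>z = 1 - 2 p\<close>. As \<open>H\<close> is not
  closed, membership has to be exact, and it is obtained from a contraction: a first order solution
  \<open>g\<close> is replaced by \<open>g z g\<^sup>* z\<close>, whose skew-adjoint part lies in the linear space of off-diagonal
  elements, and a unitary near \<open>1\<close> is determined by its skew-adjoint part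
  (\<open>unitaries_near_one_in_range\<close>).

  If \<open>p\<close> is full, then \<open>H\<close> and the unitaries of the corner \<open>p A p\<close> generate \<open>U\<close>
  (\<open>unitary_component_subset_corner_extension\<close>). Brackets of off-diagonal elements fill the corner of
  \<open>1 - p\<close> because \<open>p\<close> is full, and what they contribute to the corner of \<open>p\<close> is absorbed by the
  unitaries there. The same contraction argument turns this into a statement about all unitaries near
  \<open>1\<close>, and a subgroup of the connected group \<open>U\<close> that contains a neighbourhood of \<open>1\<close> is all of \<open>U\<close>.
\<close>

section \<open>The exponential series in a Banach algebra\<close>

lemma norm_power_Suc_diff_le:
  fixes x y :: "'a::real_normed_algebra_1"
  assumes "norm x \<le> r" "norm y \<le> r"
  shows "norm (x ^ Suc n - y ^ Suc n) \<le> real (Suc n) * r ^ n * norm (x - y)"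
proof (induction n)
  case 0
  then show ?case by simp
next
  case (Suc n)
  have r: "0 \<le> r"
    using assms(1) norm_ge_zero[of x] by linarith
  have "x ^ Suc (Suc n) - y ^ Suc (Suc n) = x * (x ^ Suc n - y ^ Suc n) + (x - y) * y ^ Suc n"
    by (simp add: algebra_simps)
  also have "norm \<dots> \<le> norm x * norm (x ^ Suc n - y ^ Suc n) + norm (x - y) * norm (y ^ Suc n)"
    by (intro order_trans[OF norm_triangle_ineq] add_mono norm_mult_ineq)
  also have "\<dots> \<le> r * (real (Suc n) * r ^ n * norm (x - y)) + norm (x - y) * r ^ Suc n"
    using assms r Suc.IH
    by (intro add_mono mult_mono order_trans[OF norm_power_ineq] power_mono) auto
  also have "\<dots> = real (Suc (Suc n)) * r ^ Suc n * norm (x - y)"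
    by (simp add: algebra_simps)
  finally show ?case .
qed

lemma exp_minus_one_sums:
  fixes x :: "'a::{real_normed_algebra_1,banach}"
  shows "(\<lambda>n. x ^ Suc n /\<^sub>R fact (Suc n)) sums (exp x - 1)"
  using exp_converges[of x] by (subst sums_Suc_iff) simp

text \<open>
  Strict differentiability of the exponential at zero, with the identity as derivative: the terms of
  order at least two are Lipschitz with the constant that the scalar series gives.
\<close>

lemma norm_exp_diff_le:
  fixes x y :: "'a::{real_normed_algebra_1,banach}"
  assumes "norm x \<le> r" "norm y \<le> r"
  shows "norm (exp x - exp y - (x - y)) \<le> (exp r - 1) * norm (x - y)"
proof (rule norm_sums_le)
  let ?f = "\<lambda>n. (x ^ Suc n - y ^ Suc n) /\<^sub>R fact (Suc n)"
  have "(\<lambda>n. x ^ Suc n /\<^sub>R fact (Suc n) - y ^ Suc n /\<^sub>R fact (Suc n)) sums (exp x - 1 - (exp y - 1))"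
    by (intro sums_diff exp_minus_one_sums)
  then have "?f sums (exp x - exp y)"
    by (simp add: scaleR_diff_right del: power_Suc fact_Suc)
  then show "(\<lambda>n. ?f n - (if n = 0 then x - y else 0)) sums (exp x - exp y - (x - y))"
    using sums_single[of 0 "\<lambda>_. x - y"] by (intro sums_diff) auto
  have "(\<lambda>n. r ^ n /\<^sub>R fact n) sums exp r"
    by (rule exp_converges)
  then show "(\<lambda>n. (r ^ n /\<^sub>R fact n - (if n = 0 then 1 else 0)) * norm (x - y)) sums
      ((exp r - 1) * norm (x - y))"
    using sums_single[of 0 "\<lambda>_. 1 :: real"] by (intro sums_mult2 sums_diff) auto
  fix n
  show "norm (?f n - (if n = 0 then x - y else 0))
      \<le> (r ^ n /\<^sub>R fact n - (if n = 0 then 1 else 0)) * norm (x - y)"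
  proof (cases "n = 0")
    case False
    have "norm (?f n) = norm (x ^ Suc n - y ^ Suc n) / fact (Suc n)"
      by (simp add: divide_inverse mult.commute del: power_Suc fact_Suc)
    also have "\<dots> \<le> real (Suc n) * r ^ n * norm (x - y) / fact (Suc n)"
      by (intro divide_right_mono norm_power_Suc_diff_le assms) simp
    also have "\<dots> = (r ^ n /\<^sub>R fact n) * norm (x - y)"
      by (simp add: field_simps del: of_nat_Suc)
    finally show ?thesis using False by simp
  qed simp
qed

text \<open>
  The factor is the power series of \<open>(e\<^sup>y - 1) / y\<close>, which is close to \<open>1\<close> for small \<open>y\<close>. So
  \<open>exp y - 1\<close> lies in every ideal that contains \<open>y\<close>, and conversely \<open>y\<close> can be estimated by
  \<open>exp y - 1\<close>.
\<close>

lemma exp_minus_one_factor: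
  fixes y :: "'a::{real_normed_algebra_1,banach}"
  shows "\<exists>q. exp y - 1 = q * y \<and> norm (q - 1) \<le> exp (norm y) - 1"
proof -
  let ?g = "\<lambda>n. y ^ n /\<^sub>R fact (Suc n)"
  have bound: "norm (?g n) \<le> norm y ^ n /\<^sub>R fact n" for n
  proof -
    have "norm (?g n) = norm (y ^ n) / fact (Suc n)"
      by (simp add: divide_inverse mult.commute)
    also have "\<dots> \<le> norm y ^ n / fact n"
      by (intro frac_le norm_power_ineq fact_mono) auto
    finally show ?thesis by (simp add: divide_inverse mult.commute)
  qed
  have e: "(\<lambda>n. norm y ^ n /\<^sub>R fact n) sums exp (norm y)"
    by (rule exp_converges)
  have "summable ?g"
    using bound sums_summable[OF e] by (rule summable_comparison_test'[rotated])
  then have q: "?g sums suminf ?g" by (rule summable_sums)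
  have "(\<lambda>n. ?g n * y) sums (suminf ?g * y)"
    by (rule sums_mult2[OF q])
  then have "(\<lambda>n. y ^ Suc n /\<^sub>R fact (Suc n)) sums (suminf ?g * y)"
    by (simp add: power_commutes del: fact_Suc)
  then have "exp y - 1 = suminf ?g * y"
    using exp_minus_one_sums sums_unique2 by blast
  moreover have "norm (suminf ?g - 1) \<le> exp (norm y) - 1"
  proof (rule norm_sums_le)
    show "(\<lambda>n. ?g n - (if n = 0 then 1 else 0)) sums (suminf ?g - 1)"
      using sums_single[of 0 "\<lambda>_. 1 :: 'a"] by (intro sums_diff q) auto
    show "(\<lambda>n. norm y ^ n /\<^sub>R fact n - (if n = 0 then 1 else 0)) sums (exp (norm y) - 1)"
      using sums_single[of 0 "\<lambda>_. 1 :: real"] by (intro sums_diff e) auto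
    show "norm (?g n - (if n = 0 then 1 else 0)) \<le> norm y ^ n /\<^sub>R fact n - (if n = 0 then 1 else 0)" for n
      using bound[of n] by (cases "n = 0") auto
  qed
  ultimately show ?thesis by blast
qed

lemma exp_minus_one_le:
  fixes r :: real
  assumes "0 \<le> r" "r \<le> 1"
  shows "exp r - 1 \<le> 2 * r"
proof -
  have "r\<^sup>2 \<le> r" using assms by (simp add: power2_eq_square mult_left_le_one_le)
  then show ?thesis using exp_bound[OF assms] by linarith
qed

section \<open>Strict derivatives at zero\<close>

text \<open>
  A derivative at zero that controls the difference of the values at any two nearby points. This is
  what the contraction principle consumes; the usual derivative compares with the value at zero only.
\<close>

definition strict_deriv :: "('a::real_normed_vector \<Rightarrow> 'b::real_normed_vector) \<Rightarrow> ('a \<Rightarrow> 'b) \<Rightarrow> bool" where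
  "strict_deriv f D \<longleftrightarrow> bounded_linear D \<and>
     (\<forall>e>0. \<exists>d>0. \<forall>x y. norm x < d \<longrightarrow> norm y < d \<longrightarrow>
        norm (f x - f y - D (x - y)) \<le> e * norm (x - y))"

lemma strict_derivD:
  assumes "strict_deriv f D" "e > 0"
  shows "\<exists>d>0. \<forall>x y. norm x < d \<longrightarrow> norm y < d \<longrightarrow> norm (f x - f y - D (x - y)) \<le> e * norm (x - y)"
  using assms unfolding strict_deriv_def by simp

lemma strict_deriv_bounded_linear: "strict_deriv f D \<Longrightarrow> bounded_linear D"
  by (simp add: strict_deriv_def)

lemma strict_deriv_Lipschitz:
  assumes "strict_deriv f D"
  shows "\<exists>d>0. \<exists>B>0. \<forall>x y. norm x < d \<longrightarrow> norm y < d \<longrightarrow> norm (f x - f y) \<le> B * norm (x - y)"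
proof -
  obtain d where d: "d > 0"
    "\<forall>x y. norm x < d \<longrightarrow> norm y < d \<longrightarrow> norm (f x - f y - D (x - y)) \<le> 1 * norm (x - y)"
    using strict_derivD[OF assms zero_less_one] by blast
  obtain K where K: "K > 0" "\<And>x. norm (D x) \<le> norm x * K"
    using bounded_linear.pos_bounded[OF strict_deriv_bounded_linear[OF assms]] by blast
  have "\<forall>x y. norm x < d \<longrightarrow> norm y < d \<longrightarrow> norm (f x - f y) \<le> (1 + K) * norm (x - y)"
  proof (intro allI impI)
    fix x y :: 'a assume "norm x < d" "norm y < d"
    then have "norm (f x - f y - D (x - y)) \<le> norm (x - y)" using d(2)[rule_format, of x y] by simp
    moreover have "norm (f x - f y) \<le> norm (f x - f y - D (x - y)) + norm (D (x - y))"
      using norm_triangle_ineq[of "f x - f y - D (x - y)" "D (x - y)"] by simp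
    ultimately show "norm (f x - f y) \<le> (1 + K) * norm (x - y)"
      using K(2)[of "x - y"] by (simp add: algebra_simps)
  qed
  moreover have "1 + K > 0" using K(1) by simp
  ultimately show ?thesis using d(1) by blast
qed

lemma strict_deriv_continuous:
  assumes "strict_deriv f D" "e > 0"
  shows "\<exists>d>0. \<forall>x. norm x < d \<longrightarrow> norm (f x - f 0) < e"
proof -
  obtain d B where d: "d > 0" "B > 0"
    "\<forall>x y. norm x < d \<longrightarrow> norm y < d \<longrightarrow> norm (f x - f y) \<le> B * norm (x - y)"
    using strict_deriv_Lipschitz[OF assms(1)] by blast
  show ?thesis
  proof (intro exI[of _ "min d (e / B)"] conjI allI impI)
    fix x :: 'a assume x: "norm x < min d (e / B)"
    then have "norm (f x - f 0) \<le> B * norm x" using d(3)[rule_format, of x 0] d(1) by simp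
    also have "\<dots> < e" using x d(2) by (simp add: field_simps)
    finally show "norm (f x - f 0) < e" .
  qed (use d assms in auto)
qed

lemma strict_deriv_const: "strict_deriv (\<lambda>x. c) (\<lambda>x. 0)"
  by (auto simp: strict_deriv_def intro!: exI[of _ 1])

lemma strict_deriv_add:
  assumes "strict_deriv f D" "strict_deriv g E"
  shows "strict_deriv (\<lambda>x. f x + g x) (\<lambda>x. D x + E x)"
  unfolding strict_deriv_def
proof (intro conjI allI impI)
  show "bounded_linear (\<lambda>x. D x + E x)"
    using assms by (intro bounded_linear_add strict_deriv_bounded_linear)
  fix e :: real assume "e > 0"
  then have e: "e / 2 > 0" by simp
  obtain d1 where d1: "d1 > 0"
    "\<forall>x y. norm x < d1 \<longrightarrow> norm y < d1 \<longrightarrow> norm (f x - f y - D (x - y)) \<le> e / 2 * norm (x - y)"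
    using strict_derivD[OF assms(1) e] by blast
  obtain d2 where d2: "d2 > 0"
    "\<forall>x y. norm x < d2 \<longrightarrow> norm y < d2 \<longrightarrow> norm (g x - g y - E (x - y)) \<le> e / 2 * norm (x - y)"
    using strict_derivD[OF assms(2) e] by blast
  show "\<exists>d>0. \<forall>x y. norm x < d \<longrightarrow> norm y < d \<longrightarrow>
      norm (f x + g x - (f y + g y) - (D (x - y) + E (x - y))) \<le> e * norm (x - y)"
  proof (intro exI[of _ "min d1 d2"] conjI allI impI)
    fix x y :: 'a assume xy: "norm x < min d1 d2" "norm y < min d1 d2"
    have "norm ((f x - f y - D (x - y)) + (g x - g y - E (x - y))) \<le> e / 2 * norm (x - y) + e / 2 * norm (x - y)"
      using xy by (intro order_trans[OF norm_triangle_ineq] add_mono d1(2)[rule_format] d2(2)[rule_format]) auto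
    then show "norm (f x + g x - (f y + g y) - (D (x - y) + E (x - y))) \<le> e * norm (x - y)"
      by (simp add: algebra_simps)
  qed (use d1 d2 in auto)
qed

lemma strict_deriv_bounded_linear_compose:
  fixes f :: "'a::real_normed_vector \<Rightarrow> 'b::real_normed_vector"
  assumes "bounded_linear L" "strict_deriv f D"
  shows "strict_deriv (\<lambda>x. L (f x)) (\<lambda>x. L (D x))"
  unfolding strict_deriv_def
proof (intro conjI allI impI)
  interpret L: bounded_linear L by fact
  show "bounded_linear (\<lambda>x. L (D x))"
    using assms by (rule bounded_linear_compose[OF _ strict_deriv_bounded_linear])
  obtain K where K: "K > 0" "\<And>x. norm (L x) \<le> norm x * K"
    using L.pos_bounded by blast
  fix e :: real assume "e > 0"
  then have e: "e / K > 0" using K by simp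
  obtain d where d: "d > 0"
    "\<forall>x y. norm x < d \<longrightarrow> norm y < d \<longrightarrow> norm (f x - f y - D (x - y)) \<le> e / K * norm (x - y)"
    using strict_derivD[OF assms(2) e] by blast
  show "\<exists>d>0. \<forall>x y. norm x < d \<longrightarrow> norm y < d \<longrightarrow>
      norm (L (f x) - L (f y) - L (D (x - y))) \<le> e * norm (x - y)"
  proof (intro exI[of _ d] conjI allI impI)
    fix x y :: 'a assume xy: "norm x < d" "norm y < d"
    have "norm (L (f x - f y - D (x - y))) \<le> norm (f x - f y - D (x - y)) * K"
      by (rule K(2))
    also have "\<dots> \<le> e / K * norm (x - y) * K"
      using d(2)[rule_format, OF xy] K(1) by (intro mult_right_mono) auto
    finally show "norm (L (f x) - L (f y) - L (D (x - y))) \<le> e * norm (x - y)"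
      using K(1) by (simp add: L.diff)
  qed (use d in auto)
qed

lemma strict_deriv_mult:
  fixes f g :: "'a::real_normed_vector \<Rightarrow> 'b::real_normed_algebra"
  assumes "strict_deriv f D" "strict_deriv g E"
  shows "strict_deriv (\<lambda>x. f x * g x) (\<lambda>x. D x * g 0 + f 0 * E x)"
proof -
  have lin: "bounded_linear (\<lambda>x. D x * g 0 + f 0 * E x)"
    using assms
    by (intro bounded_linear_add bounded_linear_mult_const bounded_linear_const_mult
        strict_deriv_bounded_linear)
  \<comment> \<open>It suffices to treat the product of the two increments from the base point: the remaining terms are linear in \<open>f\<close> and \<open>g\<close>.\<close>
  have "strict_deriv (\<lambda>x. (f x - f 0) * (g x - g 0)) (\<lambda>x. 0)"
    unfolding strict_deriv_def
  proof (intro conjI allI impI)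
    fix e :: real assume "e > 0"
    obtain d1 A where d1: "d1 > 0" "A > 0"
      "\<forall>x y. norm x < d1 \<longrightarrow> norm y < d1 \<longrightarrow> norm (f x - f y) \<le> A * norm (x - y)"
    using strict_deriv_Lipschitz[OF assms(1)] by blast
    obtain d2 B where d2: "d2 > 0" "B > 0"
      "\<forall>x y. norm x < d2 \<longrightarrow> norm y < d2 \<longrightarrow> norm (g x - g y) \<le> B * norm (x - y)"
    using strict_deriv_Lipschitz[OF assms(2)] by blast
    define d where "d = min (min d1 d2) (e / (2 * A * B))"
    have d: "d > 0" "d \<le> d1" "d \<le> d2" "d \<le> e / (2 * A * B)"
      using d1 d2 \<open>e > 0\<close> by (auto simp: d_def)
    have "norm ((f x - f 0) * (g x - g 0) - (f y - f 0) * (g y - g 0) - 0) \<le> e * norm (x - y)"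
      if xy: "norm x < d" "norm y < d" for x y
    proof -
      have "(f x - f 0) * (g x - g 0) - (f y - f 0) * (g y - g 0)
          = (f x - f y) * (g x - g 0) + (f y - f 0) * (g x - g y)"
        by (simp add: algebra_simps)
      also have "norm \<dots> \<le> norm (f x - f y) * norm (g x - g 0) + norm (f y - f 0) * norm (g x - g y)"
        by (intro order_trans[OF norm_triangle_ineq] add_mono norm_mult_ineq)
      also have "\<dots> \<le> (A * norm (x - y)) * (B * norm (x - 0)) + (A * norm (y - 0)) * (B * norm (x - y))"
        using xy d d1 d2 by (intro add_mono mult_mono d1(3)[rule_format] d2(3)[rule_format]) auto
      also have "\<dots> = A * B * (norm x + norm y) * norm (x - y)"
        by (simp add: algebra_simps)
      also have "\<dots> \<le> A * B * (d + d) * norm (x - y)"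
        using xy d1 d2 by (intro mult_right_mono mult_left_mono add_mono) auto
      also have "\<dots> \<le> e * norm (x - y)"
        using d(4) d1(2) d2(2) by (intro mult_right_mono) (auto simp: field_simps)
      finally show ?thesis by simp
    qed
    then show "\<exists>d>0. \<forall>x y. norm x < d \<longrightarrow> norm y < d \<longrightarrow>
        norm ((f x - f 0) * (g x - g 0) - (f y - f 0) * (g y - g 0) - 0) \<le> e * norm (x - y)"
      using d(1) by blast
  qed auto
  moreover have "strict_deriv (\<lambda>x. f x * g 0) (\<lambda>x. D x * g 0)"
    by (rule strict_deriv_bounded_linear_compose[OF bounded_linear_mult_left assms(1)])
  moreover have "strict_deriv (\<lambda>x. f 0 * g x) (\<lambda>x. f 0 * E x)"
    by (rule strict_deriv_bounded_linear_compose[OF bounded_linear_mult_right assms(2)])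
  ultimately have "strict_deriv (\<lambda>x. ((f x - f 0) * (g x - g 0) + (f x * g 0 + f 0 * g x)) + (- (f 0 * g 0)))
      (\<lambda>x. (0 + (D x * g 0 + f 0 * E x)) + 0)"
    by (intro strict_deriv_add strict_deriv_const)
  then show ?thesis by (simp add: algebra_simps)
qed

lemma strict_deriv_exp:
  fixes R :: "'a::real_normed_vector \<Rightarrow> 'b::{real_normed_algebra_1,banach}"
  assumes "bounded_linear R"
  shows "strict_deriv (\<lambda>x. exp (R x)) R"
  unfolding strict_deriv_def
proof (intro conjI allI impI)
  interpret R: bounded_linear R by fact
  show "bounded_linear R" by fact
  obtain K where K: "K > 0" "\<And>x. norm (R x) \<le> norm x * K"
    using R.pos_bounded by blast
  fix e :: real assume "e > 0"
  define r where "r = min 1 (e / (2 * K))"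
  have r: "0 < r" "r \<le> 1" "2 * r * K \<le> e"
    using K \<open>e > 0\<close> by (auto simp: r_def field_simps min_def)
  show "\<exists>d>0. \<forall>x y. norm x < d \<longrightarrow> norm y < d \<longrightarrow>
      norm (exp (R x) - exp (R y) - R (x - y)) \<le> e * norm (x - y)"
  proof (intro exI[of _ "r / K"] conjI allI impI)
    fix x y :: 'a assume xy: "norm x < r / K" "norm y < r / K"
    have "norm (R x) \<le> r" "norm (R y) \<le> r"
      using xy K(1) K(2)[of x] K(2)[of y] by (auto simp: field_simps)
    then have "norm (exp (R x) - exp (R y) - R (x - y)) \<le> (exp r - 1) * norm (R (x - y))"
      using norm_exp_diff_le[of "R x" r "R y"] by (simp add: R.diff)
    also have "\<dots> \<le> (2 * r) * (norm (x - y) * K)"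
      using r by (intro mult_mono exp_minus_one_le K(2)) auto
    also have "\<dots> \<le> e * norm (x - y)"
      using mult_right_mono[OF r(3) norm_ge_zero[of "x - y"]] by (simp add: algebra_simps)
    finally show "norm (exp (R x) - exp (R y) - R (x - y)) \<le> e * norm (x - y)" .
  qed (use r K in auto)
qed

text \<open>
  Only closeness of the derivative to the identity is asked for, so that the derivative may be an
  approximation of the one that is wanted. The solution is the fixed point of
  \<open>x \<mapsto> x - f x + c\<close>, and it stays in the subspace \<open>V\<close> because \<open>f\<close> preserves \<open>V\<close>.
\<close>

lemma locally_onto_if_strict_deriv_near_id:
  fixes f :: "'a::banach \<Rightarrow> 'a"
  assumes f: "strict_deriv f D" "f 0 = 0"
    and V: "closed V" "subspace V" "\<And>v. v \<in> V \<Longrightarrow> f v \<in> V"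
    and near: "\<And>v. v \<in> V \<Longrightarrow> norm (D v - v) \<le> norm v / 2"
    and "e > 0"
  shows "\<exists>d>0. \<forall>c\<in>V. norm c < d \<longrightarrow> (\<exists>x\<in>V. norm x < e \<and> f x = c)"
proof -
  obtain d where d: "d > 0"
    "\<forall>x y. norm x < d \<longrightarrow> norm y < d \<longrightarrow> norm (f x - f y - D (x - y)) \<le> 1/4 * norm (x - y)"
    using strict_derivD[OF f(1), of "1/4"] by auto
  define r where "r = min d e / 2"
  have r: "r > 0" "r < d" "r < e" using d(1) \<open>e > 0\<close> by (auto simp: r_def)
  show ?thesis
  proof (intro exI[of _ "r / 4"] conjI ballI impI)
    fix c assume c: "c \<in> V" "norm c < r / 4"
    define F where "F x = x - f x + c" for x
    define W where "W = V \<inter> cball 0 r"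
    have contr: "norm (F x - F y) \<le> 3/4 * norm (x - y)" if "x \<in> W" "y \<in> W" for x y
    proof -
      have "x - y \<in> V" using that V(2) by (auto simp: W_def intro: subspace_diff)
      have "F x - F y = - (f x - f y - D (x - y)) - (D (x - y) - (x - y))"
        by (simp add: F_def)
      also have "norm \<dots> \<le> norm (f x - f y - D (x - y)) + norm (D (x - y) - (x - y))"
        by (metis norm_triangle_ineq4 norm_minus_cancel)
      also have "\<dots> \<le> 1/4 * norm (x - y) + norm (x - y) / 2"
        using that r by (intro add_mono d(2)[rule_format] near \<open>x - y \<in> V\<close>) (auto simp: W_def)
      finally show ?thesis by simp
    qed
    have "0 \<in> W" using V(2) r(1) by (auto simp: W_def subspace_0)
    have "F x \<in> W" if "x \<in> W" for x
    proof -
      have "norm (F x) \<le> norm (F x - F 0) + norm c"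
        using norm_triangle_ineq[of "F x - F 0" "F 0"] by (simp add: F_def f(2))
      also have "\<dots> \<le> 3/4 * norm (x - 0) + norm c"
        using contr[OF that \<open>0 \<in> W\<close>] by simp
      also have "\<dots> \<le> r" using that c by (auto simp: W_def)
      finally show ?thesis
        using that c(1) V by (auto simp: W_def F_def intro!: subspace_add subspace_diff)
    qed
    moreover have "complete W"
      using V(1) by (auto simp: W_def complete_eq_closed)
    ultimately have "\<exists>!x. x \<in> W \<and> F x = x"
      using \<open>0 \<in> W\<close> contr by (intro Banach_fix[of W "3/4"]) (auto simp: dist_norm)
    then obtain x where "x \<in> W" "F x = x" by blast
    then show "\<exists>x\<in>V. norm x < e \<and> f x = c"
      using r by (intro bexI[of _ x]) (auto simp: W_def F_def)
  qed (use r in auto)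
qed

section \<open>Skew-adjoint elements and unitaries\<close>

lemmas linear_adj = bounded_linear.linear[OF bounded_linear_adj]
lemmas adj_diff = linear_diff[OF linear_adj]
lemmas adj_minus = linear_neg[OF linear_adj]
lemmas adj_zero [simp] = linear_0[OF linear_adj]

lemma scaleR_as_scaleC: "r *\<^sub>R x = complex_of_real r *\<^sub>C (x :: 'a::cstar_algebra)"
  by (simp add: scaleC_of_real)

lemma bounded_linear_scaleC_left: "bounded_linear (\<lambda>c. c *\<^sub>C (x :: 'a::cstar_algebra))"
proof (rule bounded_linear_intro[where K = "norm x"])
  show "(r *\<^sub>R c) *\<^sub>C x = r *\<^sub>R (c *\<^sub>C x)" for r c
    by (simp add: scaleR_as_scaleC scaleC_scaleC scaleR_conv_of_real[where 'a = complex])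
qed (simp_all add: scaleC_add_left norm_scaleC)

lemma bounded_linear_scaleC_right: "bounded_linear (\<lambda>x. c *\<^sub>C (x :: 'a::cstar_algebra))"
proof (rule bounded_linear_intro[where K = "cmod c"])
  show "c *\<^sub>C (r *\<^sub>R x) = r *\<^sub>R (c *\<^sub>C x)" for r and x :: 'a
    by (simp add: scaleR_as_scaleC scaleC_scaleC mult.commute)
qed (simp_all add: scaleC_add_right norm_scaleC)

lemma adj_power: "adj (x ^ n) = adj x ^ n" for x :: "'a::cstar_algebra"
  by (induction n) (simp_all add: adj_mult power_commutes)

lemma adj_exp: "adj (exp x) = exp (adj x)" for x :: "'a::cstar_algebra"
proof -
  have "(\<lambda>n. adj (x ^ n /\<^sub>R fact n)) sums adj (exp x)"
    by (rule bounded_linear.sums[OF bounded_linear_adj exp_converges])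
  then have "(\<lambda>n. adj x ^ n /\<^sub>R fact n) sums adj (exp x)"
    by (simp add: adj_scaleR adj_power)
  then show ?thesis
    by (rule sums_unique2[OF _ exp_converges])
qed

definition skew :: "'a::cstar_algebra \<Rightarrow> bool" where
  "skew x \<longleftrightarrow> adj x = - x"

definition skew_part :: "'a::cstar_algebra \<Rightarrow> 'a" where
  "skew_part x = (1/2) *\<^sub>R (x - adj x)"

lemma bounded_linear_skew_part: "bounded_linear (skew_part :: 'a::cstar_algebra \<Rightarrow> 'a)"
  unfolding skew_part_def
  by (intro bounded_linear_const_scaleR bounded_linear_sub bounded_linear_ident bounded_linear_adj)

lemmas linear_skew_part = bounded_linear.linear[OF bounded_linear_skew_part]
lemmas skew_part_add = linear_add[OF linear_skew_part]
lemmas skew_part_diff = linear_diff[OF linear_skew_part]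
lemmas skew_part_zero [simp] = linear_0[OF linear_skew_part]

lemma skew_skew_part [simp]: "skew (skew_part x)"
  by (simp add: skew_def skew_part_def adj_scaleR adj_diff adj_adj algebra_simps)

lemma skew_part_eq_self [simp]: "skew x \<Longrightarrow> skew_part x = x"
  by (simp add: skew_def skew_part_def flip: scaleR_2)

lemma norm_skew_part_le: "norm (skew_part x) \<le> norm x"
  using norm_triangle_ineq4[of x "adj x"] by (simp add: skew_part_def)

lemma skew_minus: "skew x \<Longrightarrow> skew (- x)"
  and skew_scaleR: "skew x \<Longrightarrow> skew (r *\<^sub>R x)"
  and skew_add: "skew x \<Longrightarrow> skew y \<Longrightarrow> skew (x + y)"
  by (auto simp: skew_def adj_minus adj_scaleR adj_add)

lemma skew_conj: "skew x \<Longrightarrow> skew (a * x * adj a)"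
  by (simp add: skew_def adj_mult adj_adj mult.assoc)

lemma exp_skew_adj: "skew x \<Longrightarrow> adj (exp x) = exp (- x)"
  by (simp add: adj_exp skew_def)

lemma exp_skew_unitary: "skew x \<Longrightarrow> exp x \<in> unitaries"
  using exp_minus_inverse[of x] exp_minus_inverse[of "- x"]
  by (simp add: unitaries_def exp_skew_adj)

lemma unitariesD:
  assumes "u \<in> unitaries"
  shows "adj u * u = 1" "u * adj u = 1"
  using assms by (auto simp: unitaries_def)

lemma unitary_cancel:
  assumes "u \<in> unitaries"
  shows "adj u * (u * x) = x" "u * (adj u * x) = x"
  by (simp_all add: mult.assoc[symmetric] unitariesD[OF assms])

lemma norm_unitary: "u \<in> unitaries \<Longrightarrow> norm u = 1"
  using cstar_identity[of u] norm_ge_zero[of u] by (auto simp: unitaries_def power2_eq_1_iff)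

lemma norm_unitary_conj_le: "u \<in> unitaries \<Longrightarrow> norm (u * x * adj u) \<le> norm x"
  using norm_mult_ineq[of "u * x" "adj u"] norm_mult_ineq[of u x] by (simp add: norm_unitary)

lemma unitaries_power: "u \<in> unitaries \<Longrightarrow> u ^ n \<in> unitaries"
  by (induction n) (auto intro: unitaries_mult)

text \<open>
  Near \<open>1\<close> a unitary is determined by its skew-adjoint part: \<open>(u + u\<^sup>*)\<^sup>2 = 4 + (u - u\<^sup>*)\<^sup>2\<close>, and
  square roots close to \<open>2\<close> are unique.
\<close>

lemma unitary_eq_if_skew_part_eq:
  fixes u v :: "'a::cstar_algebra"
  assumes u: "u \<in> unitaries" "norm (u - 1) < 1/2" and v: "v \<in> unitaries" "norm (v - 1) < 1/2"
    and eq: "skew_part u = skew_part v"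
  shows "u = v"
proof -
  have eq': "u - adj u = v - adj v"
    using eq by (simp add: skew_part_def)
  define A B where "A = u + adj u" and "B = v + adj v"
  have sq: "(w + adj w) * (w + adj w) = (w - adj w) * (w - adj w) + 4 * 1" if "w \<in> unitaries" for w :: 'a
    using unitariesD[OF that] by (simp add: algebra_simps)
  have "A * A = B * B"
    using sq[OF u(1)] sq[OF v(1)] eq' by (simp add: A_def B_def)
  then have "(2 *\<^sub>R 1 - A) * (A - B) + (A - B) * (2 *\<^sub>R 1 - B) = 2 *\<^sub>R (A - B) + 2 *\<^sub>R (A - B)"
    by (simp add: algebra_simps)
  also have "\<dots> = 4 *\<^sub>R (A - B)"
    by (simp flip: scaleR_left_distrib)
  finally have four: "4 *\<^sub>R (A - B) = (2 *\<^sub>R 1 - A) * (A - B) + (A - B) * (2 *\<^sub>R 1 - B)"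
    by simp
  have near: "norm (2 *\<^sub>R 1 - (w + adj w)) \<le> 1" if "norm (w - 1) < 1/2" for w :: 'a
  proof -
    have "2 *\<^sub>R 1 - (w + adj w) = - (w - 1) - adj (w - 1)"
      by (simp add: adj_diff scaleR_2)
    also have "norm \<dots> \<le> norm (- (w - 1)) + norm (adj (w - 1))"
      by (rule norm_triangle_ineq4)
    finally show ?thesis
      using that by (simp only: norm_minus_cancel norm_adj)
  qed
  have "4 * norm (A - B) = norm ((2 *\<^sub>R 1 - A) * (A - B) + (A - B) * (2 *\<^sub>R 1 - B))"
    using four by (metis abs_numeral norm_scaleR)
  also have "\<dots> \<le> norm (2 *\<^sub>R 1 - A) * norm (A - B) + norm (A - B) * norm (2 *\<^sub>R 1 - B)"
    by (intro order_trans[OF norm_triangle_ineq] add_mono norm_mult_ineq)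
  also have "\<dots> \<le> 1 * norm (A - B) + norm (A - B) * 1"
    using near[OF u(2)] near[OF v(2)]
    by (intro add_mono mult_right_mono mult_left_mono) (auto simp: A_def B_def)
  finally have "A = B" by simp
  moreover have "2 *\<^sub>R w = (w + adj w) + (w - adj w)" for w :: 'a
    by (simp add: scaleR_2)
  ultimately have "2 *\<^sub>R u = 2 *\<^sub>R v"
    using eq' by (simp only: A_def B_def)
  then show ?thesis by simp
qed

text \<open>
  The family \<open>g\<close> is compared with the identity through its skew-adjoint part, which takes values in a
  linear space; by the previous lemma nothing is lost near \<open>1\<close>.
\<close>

lemma unitaries_near_one_in_range:
  fixes g :: "'a::cstar_algebra \<Rightarrow> 'a"
  assumes g: "strict_deriv g D" "g 0 = 1" "\<And>x. g x \<in> unitaries"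
    and V: "closed V" "subspace V" "\<And>v. v \<in> V \<Longrightarrow> skew v"
    and gV: "\<And>v. v \<in> V \<Longrightarrow> skew_part (g v) \<in> V"
    and near: "\<And>v. v \<in> V \<Longrightarrow> norm (D v - v) \<le> norm v / 2"
  shows "\<exists>d>0. \<forall>u\<in>unitaries. norm (u - 1) < d \<longrightarrow> skew_part u \<in> V \<longrightarrow> u \<in> range g"
proof -
  obtain d1 where d1: "d1 > 0" "\<forall>x. norm x < d1 \<longrightarrow> norm (g x - g 0) < 1/2"
    using strict_deriv_continuous[OF g(1) half_gt_zero[OF zero_less_one]] by blast
  have skew1: "skew_part (1 :: 'a) = 0"
    by (simp add: skew_part_def)
  have "\<exists>d>0. \<forall>c\<in>V. norm c < d \<longrightarrow> (\<exists>x\<in>V. norm x < d1 \<and> skew_part (g x) = c)"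
  proof (rule locally_onto_if_strict_deriv_near_id[where f = "\<lambda>x. skew_part (g x)"
        and D = "\<lambda>x. skew_part (D x)"])
    show "strict_deriv (\<lambda>x. skew_part (g x)) (\<lambda>x. skew_part (D x))"
      by (rule strict_deriv_bounded_linear_compose[OF bounded_linear_skew_part g(1)])
    show "norm (skew_part (D v) - v) \<le> norm v / 2" if "v \<in> V" for v
    proof -
      have "skew_part (D v) - v = skew_part (D v - v)"
        using V(3)[OF that] by (simp add: skew_part_diff)
      then show ?thesis
        by (simp only:) (rule order_trans[OF norm_skew_part_le near[OF that]])
    qed
  qed (simp_all add: V gV d1(1) skew1 g(2))
  then obtain d where d: "d > 0" "\<forall>c\<in>V. norm c < d \<longrightarrow> (\<exists>x\<in>V. norm x < d1 \<and> skew_part (g x) = c)"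
    by blast
  show ?thesis
  proof (intro exI[of _ "min d (1/2)"] conjI ballI impI)
    fix u :: 'a
    assume u: "u \<in> unitaries" "norm (u - 1) < min d (1/2)" "skew_part u \<in> V"
    have "skew_part u = skew_part (u - 1)"
      by (simp only: skew_part_diff skew1 diff_0_right)
    then have "norm (skew_part u) \<le> norm (u - 1)"
      by (simp only: norm_skew_part_le)
    then have "norm (skew_part u) < d"
      using u(2) by linarith
    then obtain x where x: "norm x < d1" "skew_part (g x) = skew_part u"
      using d(2)[rule_format, OF u(3)] by blast
    have "norm (g x - 1) < 1/2"
      using d1(2)[rule_format, OF x(1)] g(2) by simp
    moreover have "norm (u - 1) < 1/2"
      using u(2) by simp
    ultimately have "g x = u"
      by (rule unitary_eq_if_skew_part_eq[OF g(3) _ u(1) _ x(2)])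
    then show "u \<in> range g" by (metis rangeI)
  qed (use d(1) in simp)
qed

text \<open>
  The bound is uniform in \<open>x\<close>: the commutator with \<open>K\<close> is an operator norm limit of difference
  quotients of conjugations, not only a pointwise one. The constant \<open>7\<close> collects the three terms
  of the expansion to second order, for \<open>s \<le> 1\<close>.
\<close>

lemma norm_conj_exp_minus_commutator_le:
  fixes K x :: "'a::cstar_algebra"
  assumes K: "skew K" and s: "norm K \<le> s" "s \<le> 1"
  shows "norm (exp K * x * exp (- K) - x - (K * x - x * K)) \<le> 7 * s * s * norm x"
proof -
  have "s \<ge> 0" using s norm_ge_zero[of K] by linarith
  have first: "norm (exp L - 1 - L) \<le> 2 * s * s" if "norm L \<le> s" for L :: 'a
  proof -
    have "norm (exp L - 1 - L) \<le> (exp s - 1) * norm L"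
      using norm_exp_diff_le[of L s 0] that \<open>s \<ge> 0\<close> by simp
    also have "\<dots> \<le> (2 * s) * s"
      using that s \<open>s \<ge> 0\<close> by (intro mult_mono exp_minus_one_le) auto
    finally show ?thesis by simp
  qed
  have "exp K * x * exp (- K) - x - (K * x - x * K)
      = (exp K - 1 - K) * x * exp (- K) + ((1 + K) * x * (exp (- K) - 1 + K) - K * x * K)"
    by (simp add: algebra_simps)
  also have "norm \<dots> \<le> norm ((exp K - 1 - K) * x * exp (- K))
      + (norm ((1 + K) * x * (exp (- K) - 1 + K)) + norm (K * x * K))"
    by (intro order_trans[OF norm_triangle_ineq] add_left_mono norm_triangle_ineq4)
  also have "\<dots> \<le> (2 * s * s) * norm x * 1 + ((1 + s) * norm x * (2 * s * s) + s * norm x * s)"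
  proof (intro add_mono order_trans[OF norm_mult_ineq] mult_mono)
    show "norm (exp (- K)) \<le> 1"
      using norm_unitary[OF exp_skew_unitary[OF skew_minus[OF K]]] by simp
    show "norm (exp K - 1 - K) \<le> 2 * s * s" using first[of K] s by simp
    show "norm (exp (- K) - 1 + K) \<le> 2 * s * s" using first[of "- K"] s by simp
    show "norm (1 + K) \<le> 1 + s" using norm_triangle_ineq[of 1 K] s by simp
  qed (use s \<open>s \<ge> 0\<close> in auto)
  also have "\<dots> \<le> 7 * s * s * norm x"
  proof -
    have "s * (s * (s * norm x)) \<le> 1 * (s * (s * norm x))"
      using s \<open>s \<ge> 0\<close> by (intro mult_right_mono) auto
    then show ?thesis by (simp add: algebra_simps)
  qed
  finally show ?thesis .
qed

lemma commutator_is_derivative_of_conjugation: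
  fixes K :: "'a::cstar_algebra"
  assumes K: "skew K" and "e > 0"
  shows "\<exists>t>0. \<forall>x. norm ((1/t) *\<^sub>R (exp (t *\<^sub>R K) * x * exp (- (t *\<^sub>R K)) - x) - (K * x - x * K)) \<le> e * norm x"
proof -
  define k where "k = norm K + 1"
  have k: "k \<ge> 1" "norm K \<le> k" by (auto simp: k_def)
  define t where "t = min (1 / k) (e / (7 * k * k))"
  have t: "t > 0" "t * k \<le> 1" "7 * t * k * k \<le> e"
    using k \<open>e > 0\<close> by (auto simp: t_def min_def field_simps)
  have "norm ((1/t) *\<^sub>R (exp (t *\<^sub>R K) * x * exp (- (t *\<^sub>R K)) - x) - (K * x - x * K)) \<le> e * norm x" for x
  proof -
    let ?d = "exp (t *\<^sub>R K) * x * exp (- (t *\<^sub>R K)) - x - (t *\<^sub>R K * x - x * t *\<^sub>R K)"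
    have "norm ?d \<le> 7 * (t * k) * (t * k) * norm x"
      using K t k by (intro norm_conj_exp_minus_commutator_le skew_scaleR) auto
    also have "\<dots> = t * ((7 * t * k * k) * norm x)" by simp
    also have "\<dots> \<le> t * (e * norm x)"
      using t by (intro mult_left_mono mult_right_mono) auto
    finally have *: "norm ?d / t \<le> e * norm x"
      using t(1) by (simp add: field_simps)
    have "(1/t) *\<^sub>R (exp (t *\<^sub>R K) * x * exp (- (t *\<^sub>R K)) - x) - (K * x - x * K) = (1/t) *\<^sub>R ?d"
      using t(1) by (simp add: algebra_simps)
    then show ?thesis
      using * t(1) by (simp only: norm_scaleR) (simp add: field_simps)
  qed
  then show ?thesis using t(1) by blast
qed

section \<open>The connected component of the identity\<close>

lemma one_in_unitary_component [simp]: "1 \<in> unitary_component"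
  by (simp add: unitary_component_def)

lemma unitary_componentI_path:
  fixes f :: "real \<Rightarrow> 'a::cstar_algebra"
  assumes "continuous_on {0..1} f" "\<And>t. f t \<in> unitaries" "f 0 = 1"
  shows "f 1 \<in> unitary_component"
proof -
  have "connected (f ` {0..1})"
    using assms(1) by (intro connected_continuous_image) auto
  moreover have "1 \<in> f ` {0..1}" using assms(3) by (metis atLeastAtMost_iff image_eqI order_refl zero_le_one)
  ultimately show ?thesis
    unfolding unitary_component_def mem_Collect_eq connected_component_def using assms(2)
    by (intro exI[of _ "f ` {0..1}"]) auto
qed

lemma exp_skew_in_unitary_component:
  assumes "skew K"
  shows "exp K \<in> unitary_component"
proof -
  have "continuous_on {0..1} (\<lambda>t. exp (t *\<^sub>R K))"
    using exp_scaleR_has_vector_derivative_right[of K]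
    by (metis continuous_on_eq_continuous_within has_vector_derivative_continuous)
  then show ?thesis
    using unitary_componentI_path[of "\<lambda>t. exp (t *\<^sub>R K)"] assms
    by (simp add: exp_skew_unitary skew_scaleR)
qed

lemma reflection_in_unitary_component:
  fixes p :: "'a::cstar_algebra"
  assumes "projection p"
  shows "1 - 2 *\<^sub>R p \<in> unitary_component"
proof -
  have p: "p * p = p" "adj p = p"
    using assms by (auto simp: projection_def)
  let ?f = "\<lambda>t. 1 + (cis (pi * t) - 1) *\<^sub>C p"
  have adjf: "adj (?f t) = 1 + (cnj (cis (pi * t)) - 1) *\<^sub>C p" for t
    by (simp add: adj_add adj_scaleC p)
  have expand: "(1 + a *\<^sub>C p) * (1 + b *\<^sub>C p) = 1 + (a + b + a * b) *\<^sub>C p" for a b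
    by (simp add: ring_distribs mult_scaleC_left mult_scaleC_right scaleC_scaleC scaleC_add_left scaleC_add_right p add_ac mult.commute)
  have prod: "(1 + (c - 1) *\<^sub>C p) * (1 + (d - 1) *\<^sub>C p) = 1" if "c * d = 1" for c d
  proof -
    have "(c - 1) + (d - 1) + (c - 1) * (d - 1) = 0"
      using that by (simp add: algebra_simps)
    then show ?thesis using expand[of "c - 1" "d - 1"] by simp
  qed
  have "cis s * cnj (cis s) = 1" "cnj (cis s) * cis s = 1" for s
    by (simp_all add: cis_cnj cis_mult)
  then have "?f t \<in> unitaries" for t
    unfolding unitaries_def mem_Collect_eq adjf by (blast intro: prod)
  moreover have "continuous_on {0..1} ?f"
    by (intro continuous_intros bounded_linear.continuous_on[OF bounded_linear_scaleC_left])
  ultimately have "?f 1 \<in> unitary_component"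
    by (intro unitary_componentI_path) auto
  moreover have "?f 1 = 1 - 2 *\<^sub>R p"
    using scaleC_of_real[of "-2" p] by simp
  ultimately show ?thesis by simp
qed

text \<open>An open subgroup of a connected group is everything.\<close>

lemma unitary_component_subset_if_nhds_one:
  fixes G :: "'a::cstar_algebra set"
  assumes one: "1 \<in> G" and mult: "\<And>u v. u \<in> G \<Longrightarrow> v \<in> G \<Longrightarrow> u * v \<in> G"
    and adj: "\<And>u. u \<in> G \<Longrightarrow> adj u \<in> G" and sub: "G \<subseteq> unitaries"
    and d: "d > 0" "\<And>u. u \<in> unitaries \<Longrightarrow> norm (u - 1) < d \<Longrightarrow> u \<in> G"
  shows "unitary_component \<subseteq> G"
proof -
  let ?U = "unitary_component :: 'a set"
  let ?A = "\<Union>g\<in>G. ball g d" and ?B = "\<Union>g\<in>?U - G. ball g d"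
  have step: "u \<in> G \<longleftrightarrow> g \<in> G" if gu: "g \<in> unitaries" "u \<in> unitaries" "dist g u < d" for g u
  proof -
    have near: "norm (adj x * y - 1) < d" if "x \<in> unitaries" "dist x y < d" for x y
    proof -
      have "adj x * y - 1 = adj x * (y - x)"
        using that by (simp add: right_diff_distrib unitariesD)
      then show ?thesis
        using that norm_mult_ineq[of "adj x" "y - x"] by (simp add: norm_unitary dist_norm norm_minus_commute)
    qed
    have "adj g * u \<in> G" "adj u * g \<in> G"
      using gu near[of g u] near[of u g] by (auto intro!: d(2) unitaries_mult unitaries_adj simp: dist_commute)
    then show ?thesis
      using mult[of g "adj g * u"] mult[of u "adj u * g"] gu by (auto simp: unitary_cancel)
  qed
  have "connected ?U"
    by (simp add: unitary_component_def connected_connected_component)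
  moreover have "open ?A" "open ?B" by auto
  moreover have "?U \<subseteq> ?A \<union> ?B"
    using d(1) centre_in_ball by blast
  moreover have "?A \<inter> ?B \<inter> ?U = {}"
  proof (rule ccontr)
    assume "?A \<inter> ?B \<inter> ?U \<noteq> {}"
    then obtain u where "u \<in> ?A" "u \<in> ?B" "u \<in> ?U"
      by blast
    then obtain g g' where "u \<in> ?U" "g \<in> G" "dist g u < d" "g' \<in> ?U - G" "dist g' u < d"
      by (elim UN_E) (simp add: mem_ball)
    then show False
      using step[of g u] step[of g' u] sub unitary_component_subset by blast
  qed
  ultimately have "?A \<inter> ?U = {} \<or> ?B \<inter> ?U = {}"
    by (intro connectedD)
  moreover have "1 \<in> ?A \<inter> ?U" using one d(1) by force
  ultimately have "?B \<inter> ?U = {}" by blast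
  then show ?thesis
    using d(1) centre_in_ball by blast
qed

section \<open>Closed ideals\<close>

lemma closed_ideal_add: "closed_ideal M \<Longrightarrow> x \<in> M \<Longrightarrow> y \<in> M \<Longrightarrow> x + y \<in> M"
  and closed_ideal_diff: "closed_ideal M \<Longrightarrow> x \<in> M \<Longrightarrow> y \<in> M \<Longrightarrow> x - y \<in> M"
  and closed_ideal_zero: "closed_ideal M \<Longrightarrow> 0 \<in> M"
  and closed_ideal_scaleC: "closed_ideal M \<Longrightarrow> x \<in> M \<Longrightarrow> c *\<^sub>C x \<in> M"
  and closed_ideal_mult_left: "closed_ideal M \<Longrightarrow> x \<in> M \<Longrightarrow> a * x \<in> M"
  and closed_ideal_mult_right: "closed_ideal M \<Longrightarrow> x \<in> M \<Longrightarrow> x * a \<in> M"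
  and closed_ideal_closed: "closed_ideal M \<Longrightarrow> closed M"
  by (simp_all add: closed_ideal_def complex_vector.subspace_add complex_vector.subspace_diff
      complex_vector.subspace_0 complex_vector.subspace_scale)

lemma closed_ideal_scaleR: "closed_ideal M \<Longrightarrow> x \<in> M \<Longrightarrow> r *\<^sub>R x \<in> M"
  by (simp add: scaleR_as_scaleC closed_ideal_scaleC)

lemma closed_ideal_power_minus_one:
  assumes "closed_ideal M" "u - 1 \<in> M"
  shows "u ^ n - 1 \<in> M"
proof (induction n)
  case 0
  then show ?case using assms by (simp add: closed_ideal_zero)
next
  case (Suc n)
  have "u ^ Suc n - 1 = u * (u ^ n - 1) + (u - 1)"
    by (simp add: algebra_simps)
  then show ?case
    using Suc assms by (simp only: closed_ideal_add closed_ideal_mult_left)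
qed

lemma mult_geometric_sum: "(u - 1) * (\<Sum>k<n. u ^ k) = u ^ n - (1 :: 'a::ring_1)"
  by (induction n) (simp_all add: algebra_simps)

text \<open>
  In the quotient C*-algebra this says that \<open>x\<^sup>* x = 0\<close> forces \<open>x = 0\<close>. The direct argument replaces
  functional calculus by the mean ergodic theorem: with the unitary \<open>u = exp (\<i> c x\<^sup>* x)\<close>, the averages
  of \<open>1, u, u\<^sup>2, \<dots>\<close> are congruent to \<open>1\<close> modulo \<open>M\<close>, while multiplication by them sends \<open>x\<^sup>* x\<close>, and
  then also \<open>x\<close>, to \<open>0\<close> in the limit.
\<close>

lemma closed_ideal_mem_if_adj_mult_mem:
  fixes x :: "'a::cstar_algebra"
  assumes M: "closed_ideal M" and xx: "adj x * x \<in> M"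
  shows "x \<in> M"
proof -
  define b where "b = adj x * x"
  \<comment> \<open>The scaling makes \<open>c b\<close> so small that \<open>exp (\<i> c b) - 1\<close> is \<open>\<i> c b\<close> times a factor near \<open>1\<close>.\<close>
  define c where "c = 1 / (4 * (norm b + 1))"
  have c: "c > 0" by (simp add: c_def add_nonneg_pos)
  define y where "y = (\<i> * complex_of_real c) *\<^sub>C b"
  have "norm b + 1 > 0" by (simp add: add_nonneg_pos)
  then have "c * (norm b + 1) = 1/4" by (simp add: c_def)
  then have "c * norm b \<le> 1/4" using c by (simp add: distrib_left)
  have ny: "norm y = c * norm b" and y4: "norm y \<le> 1/4"
    using c \<open>c * norm b \<le> 1/4\<close> by (simp_all add: y_def norm_scaleC norm_mult)
  have "adj y = (- (\<i> * complex_of_real c)) *\<^sub>C b"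
    by (simp add: y_def b_def adj_scaleC adj_mult adj_adj)
  also have "\<dots> = - y"
    unfolding y_def by (rule complex_vector.scale_minus_left)
  finally have "skew y" by (simp add: skew_def)
  have yM: "y \<in> M"
    using M xx by (simp add: y_def b_def closed_ideal_scaleC)
  define u where "u = exp y"
  have u: "u \<in> unitaries"
    using \<open>skew y\<close> by (simp add: u_def exp_skew_unitary)
  obtain q where q: "u - 1 = q * y" "norm (q - 1) \<le> exp (norm y) - 1"
    unfolding u_def using exp_minus_one_factor by blast
  have q2: "norm (q - 1) \<le> 1/2"
    using q(2) exp_minus_one_le[of "norm y"] y4 by simp
  have uM: "u - 1 \<in> M"
    using q(1) yM M by (simp add: closed_ideal_mult_left)
  define A where "A N = (1 / real (Suc N)) *\<^sub>R (\<Sum>k<Suc N. u ^ k)" for N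
  have nA: "norm (A N) \<le> 1" for N
  proof -
    have "norm (\<Sum>k<Suc N. u ^ k) \<le> (\<Sum>k<Suc N. 1)"
      by (intro sum_norm_le) (simp add: norm_unitary unitaries_power u)
    then have "norm (\<Sum>k<Suc N. u ^ k) \<le> real (Suc N)"
      by simp
    then show ?thesis
      by (simp add: A_def divide_le_eq del: sum.lessThan_Suc of_nat_Suc)
  qed
  \<comment> \<open>The averages of the powers of a unitary are almost annihilated by \<open>u - 1\<close>, hence by \<open>y\<close>.\<close>
  have yA: "norm (y * A N) \<le> 4 / real (Suc N)" for N
  proof -
    have "(u - 1) * A N = (1 / real (Suc N)) *\<^sub>R (u ^ Suc N - 1)"
      unfolding A_def mult_scaleR_right mult_geometric_sum ..
    moreover have "norm (u ^ Suc N - 1) \<le> 2"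
      using norm_triangle_ineq4[of "u ^ Suc N" 1] norm_unitary[OF unitaries_power[OF u, of "Suc N"]]
      by simp
    ultimately have 1: "norm ((u - 1) * A N) \<le> 2 / real (Suc N)"
      by (simp add: divide_right_mono del: power_Suc of_nat_Suc)
    have "norm ((q - 1) * (y * A N)) \<le> 1/2 * norm (y * A N)"
      by (intro order_trans[OF norm_mult_ineq] mult_right_mono q2) simp
    moreover have "y * A N = (u - 1) * A N - (q - 1) * (y * A N)"
      unfolding q(1) by (simp add: algebra_simps)
    then have "norm (y * A N) \<le> norm ((u - 1) * A N) + norm ((q - 1) * (y * A N))"
      by (metis norm_triangle_ineq4)
    ultimately show ?thesis using 1 by simp
  qed
  have xA: "(norm (x * A N))\<^sup>2 \<le> 4 / c / real (Suc N)" for N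
  proof -
    have "(norm (x * A N))\<^sup>2 = norm (adj (A N) * (b * A N))"
      by (simp add: b_def adj_mult mult.assoc flip: cstar_identity)
    also have "\<dots> \<le> norm (adj (A N)) * norm (b * A N)"
      by (rule norm_mult_ineq)
    also have "\<dots> \<le> 1 * norm (b * A N)"
      using nA[of N] by (intro mult_right_mono) auto
    also have "norm (y * A N) = c * norm (b * A N)"
      using c by (simp add: y_def mult_scaleC_left norm_scaleC norm_mult)
    then have "norm (b * A N) = norm (y * A N) / c"
      using c by simp
    also have "\<dots> \<le> 4 / real (Suc N) / c"
      using yA[of N] c by (intro divide_right_mono) auto
    finally show ?thesis by (simp add: field_simps)
  qed
  have mem: "x - x * A N \<in> M" for N
  proof -
    have "(\<Sum>k<n. u ^ k - 1) \<in> M" for n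
      by (induction n) (auto intro: closed_ideal_add[OF M] closed_ideal_power_minus_one[OF M uM]
          closed_ideal_zero[OF M])
    then have "x * ((- (1 / real (Suc N))) *\<^sub>R (\<Sum>k<Suc N. u ^ k - 1)) \<in> M"
      by (intro closed_ideal_mult_left closed_ideal_scaleR M)
    moreover have "(- (1 / real (Suc N))) *\<^sub>R (\<Sum>k<Suc N. u ^ k - 1) = 1 - A N"
    proof -
      have "(\<Sum>k<Suc N. u ^ k - 1) = (\<Sum>k<Suc N. u ^ k) - real (Suc N) *\<^sub>R 1"
        by (simp add: sum_subtractf scaleR_conv_of_real del: sum.lessThan_Suc)
      then show ?thesis
        by (simp add: A_def scaleR_diff_right del: sum.lessThan_Suc of_nat_Suc)
    qed
    ultimately show ?thesis
      by (simp only: right_diff_distrib mult_1_right)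
  qed
  have "\<exists>z\<in>M. dist z x < e" if "e > 0" for e
  proof -
    obtain N where "4 / c / e\<^sup>2 < real N"
      using reals_Archimedean2 by blast
    then have "4 / c / e\<^sup>2 < real (Suc N)" by simp
    then have "4 / c / real (Suc N) < e\<^sup>2"
      using that c by (simp add: field_simps del: of_nat_Suc)
    then have "(norm (x * A N))\<^sup>2 < e\<^sup>2"
      using xA[of N] by (rule le_less_trans[rotated])
    then have "norm (x * A N) < e"
      using that by (simp add: power_less_imp_less_base)
    then show ?thesis
      using mem[of N] by (intro bexI[of _ "x - x * A N"]) (auto simp: dist_norm)
  qed
  then show ?thesis
    using closed_approachable[OF closed_ideal_closed[OF M]] by blast
qed

section \<open>The span of a normal subgroup\<close>

lemma csubspace_closure:
  assumes "csubspace (V :: 'a::cstar_algebra set)"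
  shows "csubspace (closure V)"
proof (rule complex_vector.subspaceI)
  show "0 \<in> closure V"
    using complex_vector.subspace_0[OF assms] closure_subset by blast
  show "x + y \<in> closure V" if xy: "x \<in> closure V" "y \<in> closure V" for x y
  proof -
    obtain f g where "\<forall>n. f n \<in> V" "f \<longlonglongrightarrow> x" "\<forall>n. g n \<in> V" "g \<longlonglongrightarrow> y"
      using xy unfolding closure_sequential by blast
    then have "\<forall>n. f n + g n \<in> V" "(\<lambda>n. f n + g n) \<longlonglongrightarrow> x + y"
      using complex_vector.subspace_add[OF assms] by (auto intro: tendsto_add)
    then show ?thesis
      unfolding closure_sequential by (intro exI[of _ "\<lambda>n. f n + g n"] conjI)
  qed
  show "c *\<^sub>C x \<in> closure V" if x: "x \<in> closure V" for c x
  proof -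
    obtain f where "\<forall>n. f n \<in> V" "f \<longlonglongrightarrow> x"
      using x unfolding closure_sequential by blast
    then have "\<forall>n. c *\<^sub>C f n \<in> V" "(\<lambda>n. c *\<^sub>C f n) \<longlonglongrightarrow> c *\<^sub>C x"
      using complex_vector.subspace_scale[OF assms]
      by (auto intro: bounded_linear.tendsto[OF bounded_linear_scaleC_right])
    then show ?thesis
      unfolding closure_sequential by (intro exI[of _ "\<lambda>n. c *\<^sub>C f n"] conjI)
  qed
qed

text \<open>
  Every property of the closed span of a subgroup that is needed (being a subalgebra, invariance under
  conjugation) is inherited from the subgroup in this way.
\<close>

lemma closure_cspan_image_subset:
  fixes f :: "'a::cstar_algebra \<Rightarrow> 'a"
  assumes f: "bounded_linear f" "\<And>c x. f (c *\<^sub>C x) = c *\<^sub>C f x"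
    and T: "closed T" "csubspace T" and B: "\<And>b. b \<in> B \<Longrightarrow> f b \<in> T"
    and x: "x \<in> closure (cspan B)"
  shows "f x \<in> T"
proof -
  have "f x \<in> T" if "x \<in> cspan B" for x
    using that
  proof (induction rule: complex_vector.span_induct_alt)
    case base
    then show ?case
      using T linear_0[OF bounded_linear.linear[OF f(1)]] by (simp add: complex_vector.subspace_0)
  next
    case (step c x y)
    then show ?case
      using T B f by (simp add: linear_add[OF bounded_linear.linear[OF f(1)]]
          complex_vector.subspace_add complex_vector.subspace_scale)
  qed
  then have "f ` closure (cspan B) \<subseteq> T"
    using f(1) T(1) by (intro image_closure_subset linear_continuous_on) auto
  then show ?thesis using x by blast
qed

locale normal_unitary_subgroup =
  fixes H :: "'a::cstar_algebra set"
  assumes subset: "H \<subseteq> unitary_component"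
    and one: "1 \<in> H"
    and mult: "g \<in> H \<Longrightarrow> h \<in> H \<Longrightarrow> g * h \<in> H"
    and adjoint: "h \<in> H \<Longrightarrow> adj h \<in> H"
    and conj: "u \<in> unitary_component \<Longrightarrow> h \<in> H \<Longrightarrow> u * h * adj u \<in> H"
begin

lemma unitary: "h \<in> H \<Longrightarrow> h \<in> unitaries"
  using subset unitary_component_subset by blast

definition span_closure :: "'a set" where
  "span_closure = closure (cspan H)"

lemma csubspace_span_closure: "csubspace span_closure"
  unfolding span_closure_def by (intro csubspace_closure complex_vector.subspace_span)

lemmas span_closure_add = complex_vector.subspace_add[OF csubspace_span_closure]
  and span_closure_diff = complex_vector.subspace_diff[OF csubspace_span_closure]
  and span_closure_scaleC = complex_vector.subspace_scale[OF csubspace_span_closure]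

lemma closed_span_closure: "closed span_closure"
  by (simp add: span_closure_def)

lemma subgroup_subset_span_closure: "H \<subseteq> span_closure"
  unfolding span_closure_def using complex_vector.span_superset closure_subset by (rule order_trans)

lemma span_closure_image:
  assumes "bounded_linear f" "\<And>c x. f (c *\<^sub>C x) = c *\<^sub>C f x" "\<And>h. h \<in> H \<Longrightarrow> f h \<in> span_closure"
    and "x \<in> span_closure"
  shows "f x \<in> span_closure"
  using closure_cspan_image_subset[OF assms(1,2) closed_span_closure csubspace_span_closure assms(3)]
    assms(4) by (simp add: span_closure_def)

lemma span_closure_mult:
  assumes "x \<in> span_closure" "y \<in> span_closure"
  shows "x * y \<in> span_closure"
proof (rule span_closure_image[OF bounded_linear_mult_left _ _ assms(1)])
  show "h * y \<in> span_closure" if "h \<in> H" for h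
    using mult that subgroup_subset_span_closure
    by (intro span_closure_image[OF bounded_linear_mult_right _ _ assms(2)])
      (auto simp: mult_scaleC_right)
qed (simp add: mult_scaleC_left)

lemma span_closure_conj:
  assumes "u \<in> unitary_component" "x \<in> span_closure"
  shows "u * x * adj u \<in> span_closure"
proof (rule span_closure_image[OF _ _ _ assms(2)])
  show "bounded_linear (\<lambda>x. u * x * adj u)"
    by (intro bounded_linear_mult_const bounded_linear_const_mult bounded_linear_ident)
qed (use conj[OF assms(1)] subgroup_subset_span_closure in
    \<open>auto simp: mult_scaleC_left mult_scaleC_right\<close>)

text \<open>
  A closed subspace that is invariant under conjugation by the unitaries \<open>exp (t K)\<close> is invariant
  under the derivative of these conjugations, the commutator with \<open>K\<close>. Each element of the algebra is
  a complex combination of two skew-adjoint ones.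
\<close>

lemma span_closure_commutator:
  assumes "x \<in> span_closure"
  shows "a * x - x * a \<in> span_closure"
proof -
  have skew_case: "K * x - x * K \<in> span_closure" if K: "skew K" for K
  proof -
    have "\<exists>z\<in>span_closure. dist z (K * x - x * K) < e" if "e > 0" for e
    proof -
      have "e / (norm x + 1) > 0" using that by (simp add: add_nonneg_pos)
      then obtain t where t: "t > 0" "norm ((1/t) *\<^sub>R (exp (t *\<^sub>R K) * x * exp (- (t *\<^sub>R K)) - x) - (K * x - x * K))
          \<le> e / (norm x + 1) * norm x"
        using commutator_is_derivative_of_conjugation[OF K] by blast
      let ?z = "(1/t) *\<^sub>R (exp (t *\<^sub>R K) * x * exp (- (t *\<^sub>R K)) - x)"
      have "exp (t *\<^sub>R K) * x * exp (- (t *\<^sub>R K)) \<in> span_closure"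
        using span_closure_conj[OF exp_skew_in_unitary_component[OF skew_scaleR[OF K]] assms]
        by (simp add: exp_skew_adj skew_scaleR K)
      then have "?z \<in> span_closure"
        unfolding scaleR_as_scaleC by (intro span_closure_scaleC span_closure_diff assms)
      moreover have "norm x + 1 > 0" by (simp add: add_nonneg_pos)
      then have "e / (norm x + 1) * norm x < e"
        using that by (simp add: pos_divide_less_eq)
      then have "dist ?z (K * x - x * K) < e"
        using t(2) by (simp add: dist_norm)
      ultimately show ?thesis by blast
    qed
    then show ?thesis
      using closed_approachable[OF closed_span_closure] by blast
  qed
  define b where "b = skew_part (\<i> *\<^sub>C a)"
  have a: "a = skew_part a - \<i> *\<^sub>C b"
  proof -
    have "\<i> *\<^sub>C b = (1/2) *\<^sub>R (\<i> *\<^sub>C (\<i> *\<^sub>C a - adj (\<i> *\<^sub>C a)))"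
      by (simp add: b_def skew_part_def scaleR_as_scaleC scaleC_scaleC mult.commute)
    also have "\<i> *\<^sub>C (\<i> *\<^sub>C a - adj (\<i> *\<^sub>C a)) = - a - adj a"
      by (simp add: adj_scaleC scaleC_scaleC scaleC_add_right)
    finally have "skew_part a - \<i> *\<^sub>C b = (1/2) *\<^sub>R (a + a)"
      by (simp add: skew_part_def flip: scaleR_diff_right)
    then show ?thesis
      by (simp flip: scaleR_2)
  qed
  have "a * x - x * a = (skew_part a * x - x * skew_part a) - \<i> *\<^sub>C (b * x - x * b)"
    by (subst (1 2) a) (simp add: algebra_simps mult_scaleC_left mult_scaleC_right
        complex_vector.scale_right_diff_distrib)
  also have "\<dots> \<in> span_closure"
    by (intro span_closure_diff span_closure_scaleC skew_case) (simp_all add: b_def)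
  finally show ?thesis .
qed

text \<open>
  Herstein's argument. The largest ideal \<open>M\<close> inside the closed Lie ideal and subalgebra \<open>S\<close> contains
  \<open>[S, S]\<close>, because \<open>a [s, t] = [s, a t] - [s, a] t\<close>. So the derivation \<open>d = [h, \<sqdot>]\<close> with \<open>h \<in> H\<close> satisfies
  \<open>d\<^sup>2 = 0\<close> modulo \<open>M\<close>; expanding \<open>d\<^sup>2 (a b)\<close> gives \<open>d a d b = 0\<close> and then \<open>d a A d a = 0\<close> modulo \<open>M\<close>, and
  C*-algebras have no such elements except zero.
\<close>

lemma closure_cspan_eq_UNIV:
  assumes "closed_ideal_generated (commutator_span H unitary_component) = UNIV"
  shows "closure (cspan H) = UNIV"
proof -
  define M where "M = {x. \<forall>a b. a * x * b \<in> span_closure}"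
  have M: "closed_ideal M"
    unfolding closed_ideal_def
  proof (intro conjI allI ballI)
    show "csubspace M"
    proof (rule complex_vector.subspaceI)
      show "0 \<in> M" using complex_vector.subspace_0[OF csubspace_span_closure] by (simp add: M_def)
    qed (auto simp: M_def ring_distribs mult_scaleC_left mult_scaleC_right
        intro: span_closure_add span_closure_scaleC)
    show "a * x \<in> M" "x * a \<in> M" if "x \<in> M" for a x
    proof -
      have "u * x * v \<in> span_closure" for u v
        using that by (simp add: M_def)
      then have "(u * a) * x * v \<in> span_closure" "u * x * (a * v) \<in> span_closure" for u v
        by blast+
      then show "a * x \<in> M" "x * a \<in> M"
        by (simp_all add: M_def mult.assoc)
    qed
    have "M = (\<Inter>a. \<Inter>b. (\<lambda>x. a * x * b) -` span_closure)"
      by (auto simp: M_def)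
    also have "closed \<dots>"
      by (intro closed_INT ballI continuous_closed_vimage closed_span_closure continuous_intros)
    finally show "closed M" .
  qed
  have comm: "s * t - t * s \<in> M" if s: "s \<in> span_closure" and t: "t \<in> span_closure" for s t
  proof -
    have left: "a * (s * t - t * s) \<in> span_closure" for a
    proof -
      have "a * (s * t - t * s) = - (a * t * s - s * (a * t)) + (a * s - s * a) * t"
        by (simp add: algebra_simps)
      also have "- (a * t * s - s * (a * t)) = 0 - (a * t * s - s * (a * t))" by simp
      also have "0 - (a * t * s - s * (a * t)) + (a * s - s * a) * t \<in> span_closure"
        by (intro span_closure_add span_closure_diff span_closure_mult span_closure_commutator s t
            complex_vector.subspace_0[OF csubspace_span_closure])
      finally show ?thesis .
    qed
    have "a * (s * t - t * s) * b \<in> span_closure" for a b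
    proof -
      let ?y = "a * (s * t - t * s)"
      have "?y * b = (b * a) * (s * t - t * s) - (b * ?y - ?y * b)"
        by (simp add: algebra_simps)
      also have "\<dots> \<in> span_closure"
        by (intro span_closure_diff left span_closure_commutator)
      finally show ?thesis .
    qed
    then show ?thesis by (simp add: M_def)
  qed
  have d_mem: "h * a - a * h \<in> M" if h: "h \<in> H" for h a
  proof -
    define d where "d a = h * a - a * h" for a
    have hS: "h \<in> span_closure" using h subgroup_subset_span_closure by blast
    have leibniz: "d (a * b) = d a * b + a * d b" and d_add: "d (a + b) = d a + d b" for a b
      by (simp_all add: d_def algebra_simps)
    have dS: "d a \<in> span_closure" for a
    proof -
      have "d a = 0 - (a * h - h * a)" by (simp add: d_def)
      then show ?thesis
        using span_closure_diff[OF complex_vector.subspace_0[OF csubspace_span_closure]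
            span_closure_commutator[OF hS]] by simp
    qed
    have dd: "d (d a) \<in> M" for a
      using comm[OF hS dS[of a]] by (simp add: d_def[of "d a"])
    have dprod: "d a * d b \<in> M" for a b
    proof -
      have "d (d (a * b)) - d (d a) * b - a * d (d b) = 2 *\<^sub>R (d a * d b)"
        by (simp add: leibniz d_add scaleR_2)
      then have "d a * d b = (1/2) *\<^sub>R (d (d (a * b)) - d (d a) * b - a * d (d b))"
        by simp
      also have "\<dots> \<in> M"
        by (intro closed_ideal_scaleR closed_ideal_diff closed_ideal_mult_left
            closed_ideal_mult_right dd M)
      finally show ?thesis .
    qed
    have sandwich: "d a * c * d a \<in> M" for c
    proof -
      have "d a * c * d a = d a * d (c * a) - (d a * d c) * a"
        by (simp add: leibniz algebra_simps)
      also have "\<dots> \<in> M"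
        by (intro closed_ideal_diff closed_ideal_mult_right dprod M)
      finally show ?thesis .
    qed
    have "adj (d a) * (d a * adj (d a) * d a) \<in> M"
      by (intro closed_ideal_mult_left sandwich M)
    then have "adj (adj (d a) * d a) * (adj (d a) * d a) \<in> M"
      by (simp add: adj_mult adj_adj mult.assoc)
    then have "adj (d a) * d a \<in> M"
      by (rule closed_ideal_mem_if_adj_mult_mem[OF M])
    then have "d a \<in> M"
      by (rule closed_ideal_mem_if_adj_mult_mem[OF M])
    then show ?thesis by (simp add: d_def)
  qed
  have "commutator_span H unitary_component \<subseteq> M"
    unfolding commutator_span_def using d_mem M
    by (intro complex_vector.span_minimal) (auto simp: closed_ideal_def)
  then have "M = UNIV"
    using hull_minimal[of _ M closed_ideal] M assms by blast
  then have "1 * x * 1 \<in> span_closure" for x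
    unfolding M_def by blast
  then show ?thesis by (auto simp: span_closure_def)
qed

end

section \<open>Tangent maps of a subgroup\<close>

text \<open>
  \<open>D\<close> is the derivative at \<open>0\<close> of a family of elements of \<open>G\<close> that starts at \<open>1\<close>; the parameter of
  the family is an arbitrary element of the algebra. Sums of such maps come from products in \<open>G\<close>.
\<close>

definition tangent_map :: "'a::cstar_algebra set \<Rightarrow> ('a \<Rightarrow> 'a) \<Rightarrow> bool" where
  "tangent_map G D \<longleftrightarrow> (\<exists>g. strict_deriv g D \<and> g 0 = 1 \<and> (\<forall>x. g x \<in> G))"

text \<open>
  The closure of the tangent maps in the operator norm. It is what is computed with, because it also
  contains limits of difference quotients.
\<close>

definition approx_tangent_map :: "'a::cstar_algebra set \<Rightarrow> ('a \<Rightarrow> 'a) \<Rightarrow> bool" where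
  "approx_tangent_map G L \<longleftrightarrow> (\<forall>e>0. \<exists>D. tangent_map G D \<and> (\<forall>x. norm (D x - L x) \<le> e * norm x))"

lemma tangent_mapI:
  assumes "strict_deriv g D" "g 0 = 1" "\<And>x. g x \<in> G"
  shows "tangent_map G D"
  unfolding tangent_map_def using assms by (intro exI[of _ g] conjI allI)

lemma tangent_map_zero: "1 \<in> G \<Longrightarrow> tangent_map G (\<lambda>x. 0)"
  by (rule tangent_mapI[OF strict_deriv_const]) auto

lemma tangent_map_exp:
  assumes "bounded_linear R" "\<And>x. exp (R x) \<in> G"
  shows "tangent_map G R"
  using assms by (intro tangent_mapI[OF strict_deriv_exp]) (auto simp: linear_0[OF bounded_linear.linear])

lemma tangent_map_add:
  assumes "\<And>u v. u \<in> G \<Longrightarrow> v \<in> G \<Longrightarrow> u * v \<in> G" "tangent_map G D" "tangent_map G E"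
  shows "tangent_map G (\<lambda>x. D x + E x)"
proof -
  obtain f where f: "strict_deriv f D" "f 0 = 1" "\<And>x. f x \<in> G"
    using assms(2) unfolding tangent_map_def by auto
  obtain g where g: "strict_deriv g E" "g 0 = 1" "\<And>x. g x \<in> G"
    using assms(3) unfolding tangent_map_def by auto
  show ?thesis
    using strict_deriv_mult[OF f(1) g(1)] f(2,3) g(2,3) assms(1)
    by (intro tangent_mapI[where g = "\<lambda>x. f x * g x"]) auto
qed

lemma tangent_map_imp_approx: "tangent_map G D \<Longrightarrow> approx_tangent_map G D"
  unfolding approx_tangent_map_def by (intro allI impI exI[of _ D]) auto

lemma approx_tangent_map_add:
  assumes "\<And>u v. u \<in> G \<Longrightarrow> v \<in> G \<Longrightarrow> u * v \<in> G" "approx_tangent_map G L" "approx_tangent_map G M"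
  shows "approx_tangent_map G (\<lambda>x. L x + M x)"
  unfolding approx_tangent_map_def
proof (intro allI impI)
  fix e :: real assume "e > 0"
  then have "e / 2 > 0" by simp
  then obtain D E where DE: "tangent_map G D" "\<forall>x. norm (D x - L x) \<le> e / 2 * norm x"
      "tangent_map G E" "\<forall>x. norm (E x - M x) \<le> e / 2 * norm x"
    using assms(2,3) unfolding approx_tangent_map_def by metis
  have "norm (D x + E x - (L x + M x)) \<le> e * norm x" for x
    using norm_triangle_ineq[of "D x - L x" "E x - M x"] DE(2)[rule_format, of x] DE(4)[rule_format, of x]
    by (simp add: algebra_simps)
  then show "\<exists>D. tangent_map G D \<and> (\<forall>x. norm (D x - (L x + M x)) \<le> e * norm x)"
    using tangent_map_add[OF assms(1) DE(1) DE(3)] by blast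
qed

lemma approx_tangent_map_limit:
  assumes "\<And>e. e > 0 \<Longrightarrow> \<exists>M. approx_tangent_map G M \<and> (\<forall>x. norm (M x - L x) \<le> e * norm x)"
  shows "approx_tangent_map G L"
  unfolding approx_tangent_map_def
proof (intro allI impI)
  fix e :: real assume "e > 0"
  then have e: "e / 2 > 0" by simp
  obtain M where M: "approx_tangent_map G M" "\<forall>x. norm (M x - L x) \<le> e / 2 * norm x"
    using assms[OF e] by blast
  obtain D where D: "tangent_map G D" "\<forall>x. norm (D x - M x) \<le> e / 2 * norm x"
    using M(1) e unfolding approx_tangent_map_def by metis
  have "norm (D x - L x) \<le> e * norm x" for x
    using norm_triangle_ineq[of "D x - M x" "M x - L x"] D(2)[rule_format, of x] M(2)[rule_format, of x]
    by simp
  then show "\<exists>D. tangent_map G D \<and> (\<forall>x. norm (D x - L x) \<le> e * norm x)"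
    using D(1) by blast
qed

lemma skew_part_conj: "skew_part (u * x * adj u) = u * skew_part x * adj u"
  by (simp add: skew_part_def adj_mult adj_adj mult.assoc right_diff_distrib left_diff_distrib)

lemma norm_commutator_le: "norm (s * y - y * s) \<le> 2 * norm s * norm (y :: 'a::real_normed_algebra)"
proof -
  have "norm (s * y - y * s) \<le> norm s * norm y + norm y * norm s"
    by (intro order_trans[OF norm_triangle_ineq4] add_mono norm_mult_ineq)
  then show ?thesis by simp
qed

lemma exp_involution_conj:
  fixes z x :: "'a::{real_normed_algebra_1,banach}"
  assumes "z * z = 1"
  shows "z * exp x * z = exp (z * x * z)"
proof -
  have pow: "z * x ^ n * z = (z * x * z) ^ n" for n
  proof (induction n)
    case (Suc n)
    have "z * x ^ Suc n * z = z * x * (z * z) * x ^ n * z"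
      by (simp add: assms mult.assoc)
    then show ?case
      using Suc by (simp add: mult.assoc)
  qed (simp add: assms)
  have "bounded_linear (\<lambda>x. z * x * z)"
    by (intro bounded_linear_mult_const bounded_linear_const_mult bounded_linear_ident)
  then have "(\<lambda>n. z * (x ^ n /\<^sub>R fact n) * z) sums (z * exp x * z)"
    by (rule bounded_linear.sums[OF _ exp_converges])
  then have "(\<lambda>n. (z * x * z) ^ n /\<^sub>R fact n) sums (z * exp x * z)"
    by (simp add: pow)
  then show ?thesis
    by (rule sums_unique2[OF _ exp_converges])
qed

lemma exp_scaleR_of_nat:
  fixes x :: "'a::{real_normed_algebra_1,banach}"
  shows "exp (real n *\<^sub>R x) = exp x ^ n"
proof (induction n)
  case (Suc n)
  have "exp (real (Suc n) *\<^sub>R x) = exp (x + real n *\<^sub>R x)"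
    by (simp add: scaleR_left_distrib add.commute)
  also have "\<dots> = exp x * exp (real n *\<^sub>R x)"
    by (intro exp_add_commuting) simp
  finally show ?case using Suc by simp
qed simp

section \<open>Exponentials of off-diagonal elements\<close>

text \<open>
  The skew-adjoint elements whose two diagonal corners with respect to \<open>p\<close> vanish. They are described
  through the symmetry \<open>1 - 2 p\<close>, with which they anticommute.
\<close>

definition off_diagonal :: "'a::cstar_algebra \<Rightarrow> 'a set" where
  "off_diagonal p = {x. skew x \<and> (1 - 2 *\<^sub>R p) * x = - (x * (1 - 2 *\<^sub>R p))}"

lemma subspace_off_diagonal: "subspace (off_diagonal p)"
  by (rule subspaceI)
    (auto simp: off_diagonal_def skew_add skew_scaleR distrib_left distrib_right, simp add: skew_def)

lemma closed_off_diagonal: "closed (off_diagonal p)"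
  unfolding off_diagonal_def skew_def
  by (intro closed_Collect_conj closed_Collect_eq continuous_intros
      linear_continuous_on bounded_linear_adj)

lemma reflection_properties:
  assumes "projection p"
  shows "(1 - 2 *\<^sub>R p) * (1 - 2 *\<^sub>R p) = 1" "adj (1 - 2 *\<^sub>R p) = 1 - 2 *\<^sub>R p"
proof -
  have p: "p * p = p" "adj p = p" using assms by (auto simp: projection_def)
  show "adj (1 - 2 *\<^sub>R p) = 1 - 2 *\<^sub>R p"
    by (simp add: adj_diff adj_scaleR p)
  have "(1 - 2 *\<^sub>R p) * (1 - 2 *\<^sub>R p) = 1 + (4 *\<^sub>R p - (2 *\<^sub>R p + 2 *\<^sub>R p))"
    by (simp add: algebra_simps p)
  also have "2 *\<^sub>R p + 2 *\<^sub>R p = 4 *\<^sub>R p"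
    by (simp flip: scaleR_left_distrib)
  finally show "(1 - 2 *\<^sub>R p) * (1 - 2 *\<^sub>R p) = 1" by simp
qed

context normal_unitary_subgroup
begin

lemma power_mem: "h \<in> H \<Longrightarrow> h ^ n \<in> H"
  by (induction n) (auto intro: one mult)

text \<open>
  The derivative of the group commutator of \<open>h\<close> and \<open>exp (V x)\<close>, which lies in \<open>H\<close> by normality.
\<close>

lemma tangent_map_conj_minus_id:
  assumes h: "h \<in> H" and V: "bounded_linear V" "\<And>x. skew (V x)"
  shows "tangent_map H (\<lambda>x. h * V x * adj h - V x)"
proof (rule tangent_mapI)
  have V0: "V 0 = 0" by (rule linear_0[OF bounded_linear.linear[OF V(1)]])
  have "bounded_linear (\<lambda>x. h * x * adj h)"
    by (intro bounded_linear_mult_const bounded_linear_const_mult bounded_linear_ident)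
  then have "strict_deriv (\<lambda>x. h * exp (V x) * adj h) (\<lambda>x. h * V x * adj h)"
    by (rule strict_deriv_bounded_linear_compose[OF _ strict_deriv_exp[OF V(1)]])
  from strict_deriv_mult[OF this strict_deriv_exp[OF bounded_linear_minus[OF V(1)]]]
  show "strict_deriv (\<lambda>x. h * exp (V x) * adj h * exp (- V x)) (\<lambda>x. h * V x * adj h - V x)"
    using unitariesD[OF unitary[OF h]] by (simp add: V0)
  show "h * exp (V 0) * adj h * exp (- V 0) = 1"
    using unitariesD[OF unitary[OF h]] by (simp add: V0)
  fix x
  have "exp (V x) * adj h * exp (- V x) \<in> H"
    using conj[OF exp_skew_in_unitary_component[OF V(2)[of x]] adjoint[OF h]]
    by (simp add: exp_skew_adj V(2))
  then show "h * exp (V x) * adj h * exp (- V x) \<in> H"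
    using mult[OF h] by (simp add: mult.assoc)
qed

text \<open>
  For \<open>s = h\<close> the commutator \<open>[h, y]\<close> is \<open>h W h\<^sup>* - W\<close> with \<open>W = y h\<close>. The operator \<open>B\<close> varies in the
  induction because a complex coefficient of \<open>h\<close> has to be moved into the argument, where only the
  skew-adjoint part enters.
\<close>

lemma tangent_map_commutator_of_span:
  assumes "s \<in> cspan H" "bounded_linear B"
  shows "tangent_map H (\<lambda>x. skew_part (s * B x - B x * s))"
  using assms
proof (induction arbitrary: B rule: complex_vector.span_induct_alt)
  case base
  then show ?case by (simp add: tangent_map_zero one)
next
  case (step c h y)
  define V where "V x = skew_part (c *\<^sub>C B x * h)" for x
  have linV: "bounded_linear V"
    unfolding V_def
    by (rule bounded_linear_compose[OF bounded_linear_skew_part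
          bounded_linear_mult_const[OF bounded_linear_compose[OF bounded_linear_scaleC_right step.prems]]])
  have "skew (V x)" for x by (simp add: V_def)
  then have "tangent_map H (\<lambda>x. h * V x * adj h - V x)"
    by (rule tangent_map_conj_minus_id[OF step.hyps(1) linV])
  moreover have "h * V x * adj h - V x = skew_part (c *\<^sub>C h * B x - B x * c *\<^sub>C h)" for x
  proof -
    have "h * V x * adj h - V x = skew_part (h * (c *\<^sub>C B x * h) * adj h - c *\<^sub>C B x * h)"
      unfolding V_def skew_part_conj[symmetric] skew_part_diff ..
    also have "h * (c *\<^sub>C B x * h) * adj h - c *\<^sub>C B x * h = c *\<^sub>C h * B x - B x * c *\<^sub>C h"
      using unitariesD(2)[OF unitary[OF step.hyps(1)]]
      by (simp add: mult.assoc mult_scaleC_left mult_scaleC_right)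
    finally show ?thesis .
  qed
  ultimately have "tangent_map H (\<lambda>x. skew_part (c *\<^sub>C h * B x - B x * c *\<^sub>C h))"
    by simp
  from tangent_map_add[OF mult this step.IH[OF step.prems]]
  show ?case
    by (simp add: algebra_simps flip: skew_part_add)
qed

lemma approx_tangent_map_commutator:
  assumes dense: "closure (cspan H) = UNIV" and B: "bounded_linear B"
  shows "approx_tangent_map H (\<lambda>x. skew_part (s * B x - B x * s))"
proof (rule approx_tangent_map_limit)
  fix e :: real assume "e > 0"
  obtain K where K: "K > 0" "\<And>x. norm (B x) \<le> norm x * K"
    using bounded_linear.pos_bounded[OF B] by blast
  have "e / (2 * K) > 0" using K(1) \<open>e > 0\<close> by simp
  then obtain r where r: "r \<in> cspan H" "dist r s < e / (2 * K)"
    using closure_approachable[of s "cspan H"] dense by blast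
  have "norm (skew_part (r * B x - B x * r) - skew_part (s * B x - B x * s)) \<le> e * norm x" for x
  proof -
    have "norm (skew_part (r * B x - B x * r) - skew_part (s * B x - B x * s))
        = norm (skew_part ((r - s) * B x - B x * (r - s)))"
      by (simp add: algebra_simps flip: skew_part_diff)
    also have "\<dots> \<le> 2 * norm (r - s) * norm (B x)"
      by (rule order_trans[OF norm_skew_part_le norm_commutator_le])
    also have "\<dots> \<le> 2 * (e / (2 * K)) * (norm x * K)"
      using r(2) K \<open>e > 0\<close> by (intro mult_mono) (auto simp: dist_norm)
    finally show ?thesis using K(1) by simp
  qed
  then show "\<exists>M. approx_tangent_map H M \<and>
      (\<forall>x. norm (M x - skew_part (s * B x - B x * s)) \<le> e * norm x)"
    using tangent_map_imp_approx[OF tangent_map_commutator_of_span[OF r(1) B]] by blast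
qed

text \<open>
  With \<open>z = 1 - 2 p\<close> every off-diagonal \<open>x\<close> is a commutator, \<open>x = [z, z x / 2]\<close>, so \<open>H\<close> contains
  elements \<open>g\<close> with \<open>g = 1 + x/2\<close> to first order. The correction of higher order is removed by passing
  to \<open>s = g z g\<^sup>* z\<close>: since \<open>z s z = s\<^sup>*\<close>, the skew-adjoint part of \<open>s\<close> is exactly off-diagonal, and
  it determines \<open>s\<close>.
\<close>

lemma exp_off_diagonal_near_one:
  assumes dense: "closure (cspan H) = UNIV" and p: "projection p"
  shows "\<exists>d>0. \<forall>K\<in>off_diagonal p. norm (exp K - 1) < d \<longrightarrow> exp K \<in> H"
proof -
  define z where "z = 1 - 2 *\<^sub>R p"
  have zz: "z * z = 1" and az: "adj z = z"
    using reflection_properties[OF p] by (simp_all add: z_def)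
  have zzx: "z * (z * x) = x" for x by (simp add: zz flip: mult.assoc)
  have zU: "z \<in> unitary_component"
    using reflection_in_unitary_component[OF p] by (simp add: z_def)
  then have "z \<in> unitaries" using unitary_component_subset by blast
  have V: "x \<in> off_diagonal p \<longleftrightarrow> skew x \<and> z * x = - (x * z)" for x
    by (simp add: off_diagonal_def z_def)
  \<comment> \<open>\<open>1/4\<close> instead of \<open>1/2\<close>, because \<open>s\<close> below moves away from \<open>1\<close> twice as fast as \<open>g\<close>.\<close>
  define B where "B x = (1/4) *\<^sub>R (z * x)" for x
  have "bounded_linear B"
    unfolding B_def by (intro bounded_linear_const_scaleR bounded_linear_const_mult bounded_linear_ident)
  from approx_tangent_map_commutator[OF dense this, of z]
  obtain D where D: "tangent_map H D" "\<forall>x. norm (D x - skew_part (z * B x - B x * z)) \<le> 1/4 * norm x"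
    unfolding approx_tangent_map_def by (metis zero_less_divide_1_iff zero_less_numeral)
  obtain g where g: "strict_deriv g D" "g 0 = 1" "\<And>x. g x \<in> H"
    using D(1) unfolding tangent_map_def by auto
  define s where "s x = g x * (z * adj (g x) * z)" for x
  have lin: "bounded_linear (\<lambda>x. z * adj x * z)"
    by (intro bounded_linear_mult_const bounded_linear_const_mult bounded_linear_adj)
  have s0: "s 0 = 1" by (simp add: s_def g zz)
  have sH: "s x \<in> H" for x
    unfolding s_def using mult[OF g(3) conj[OF zU adjoint[OF g(3)]]] by (simp add: az)
  have sderiv: "strict_deriv s (\<lambda>x. D x + z * adj (D x) * z)"
    unfolding s_def
    using strict_deriv_mult[OF g(1) strict_deriv_bounded_linear_compose[OF lin g(1)]] by (simp add: g zz)
  have "\<exists>d>0. \<forall>u\<in>unitaries. norm (u - 1) < d \<longrightarrow> skew_part u \<in> off_diagonal p \<longrightarrow> u \<in> range s"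
  proof (rule unitaries_near_one_in_range[OF sderiv s0])
    show "s x \<in> unitaries" for x using unitary[OF sH] .
    show "skew_part (s v) \<in> off_diagonal p" for v
    proof -
      have "z * s v = adj (s v) * z" "z * adj (s v) = s v * z"
        by (simp_all add: s_def adj_mult adj_adj az mult.assoc zz zzx)
      then have "z * skew_part (s v) = - (skew_part (s v) * z)"
        by (simp add: skew_part_def right_diff_distrib left_diff_distrib flip: scaleR_minus_right)
      then show ?thesis by (simp add: V)
    qed
    show "norm (D v + z * adj (D v) * z - v) \<le> norm v / 2" if "v \<in> off_diagonal p" for v
    proof -
      have sk: "adj v = - v" and zv: "z * v = - (v * z)" using that by (auto simp: V skew_def)
      have zvz: "z * (v * z) = - v"
        using arg_cong[OF zv, of "\<lambda>y. y * z"] by (simp add: mult.assoc zz)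
      have "z * B v - B v * z = (1/4) *\<^sub>R (v + v)"
        by (simp add: B_def zzx zvz mult.assoc scaleR_add_right)
      also have "\<dots> = (1/2) *\<^sub>R v" by (simp flip: scaleR_2)
      finally have "skew_part (z * B v - B v * z) = (1/2) *\<^sub>R v"
        using that by (simp add: skew_scaleR V)
      then have E: "norm (D v - (1/2) *\<^sub>R v) \<le> 1/4 * norm v" (is "norm ?E \<le> _")
        using D(2) by metis
      have "z * adj ?E * z = z * adj (D v) * z + (1/2) *\<^sub>R (z * (v * z))"
        by (simp add: adj_diff adj_scaleR sk algebra_simps)
      then have "D v + z * adj (D v) * z - v = ?E + z * adj ?E * z + ((1/2) *\<^sub>R v + (1/2) *\<^sub>R v - v)"
        by (simp add: zvz)
      also have "(1/2) *\<^sub>R v + (1/2) *\<^sub>R v - v = 0"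
        by (simp flip: scaleR_left_distrib)
      finally have "norm (D v + z * adj (D v) * z - v) \<le> norm ?E + norm (z * adj ?E * z)"
        by (simp only: add_0_right norm_triangle_ineq)
      also have "norm (z * adj ?E * z) \<le> norm ?E"
        using norm_unitary_conj_le[OF \<open>z \<in> unitaries\<close>, of "adj ?E"] by (simp add: az)
      finally show ?thesis using E by simp
    qed
  qed (auto simp: V closed_off_diagonal subspace_off_diagonal)
  then obtain d where d: "d > 0"
    "\<forall>u\<in>unitaries. norm (u - 1) < d \<longrightarrow> skew_part u \<in> off_diagonal p \<longrightarrow> u \<in> range s"
    by blast
  have "exp K \<in> H" if K: "K \<in> off_diagonal p" "norm (exp K - 1) < d" for K
  proof -
    have sk: "skew K" and zK: "z * K * z = - K"
      using K by (auto simp: V mult.assoc zz)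
    have "z * exp K * z * z = exp (- K) * z" "z * exp (- K) * z * z = exp K * z"
      using exp_involution_conj[OF zz, of K] exp_involution_conj[OF zz, of "- K"] zK by simp_all
    then have "z * exp K = exp (- K) * z" "z * exp (- K) = exp K * z"
      by (simp_all add: mult.assoc zz)
    then have "z * skew_part (exp K) = - (skew_part (exp K) * z)"
      by (simp add: skew_part_def exp_skew_adj sk right_diff_distrib left_diff_distrib
          flip: scaleR_minus_right)
    then have "exp K \<in> range s"
      using d(2)[rule_format, OF exp_skew_unitary[OF sk] K(2)] by (simp add: V)
    then show ?thesis using sH by auto
  qed
  then show ?thesis using d(1) by blast
qed

text \<open>
  The subgroup generated by exponentials of small elements contains the exponentials of all.
\<close>

lemma exp_off_diagonal_mem:
  assumes dense: "closure (cspan H) = UNIV" and p: "projection p" and K: "K \<in> off_diagonal p"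
  shows "exp K \<in> H"
proof -
  obtain d where d: "d > 0" "\<forall>L\<in>off_diagonal p. norm (exp L - 1) < d \<longrightarrow> exp L \<in> H"
    using exp_off_diagonal_near_one[OF dense p] by blast
  obtain c where c: "c > 0" "\<forall>x :: 'a. norm x < c \<longrightarrow> norm (exp x - exp 0) < d"
    using strict_deriv_continuous[OF strict_deriv_exp[OF bounded_linear_ident] d(1)] by blast
  obtain n where "norm K / c < real n"
    using reals_Archimedean2 by blast
  then have n: "norm K < c * real (Suc n)"
    using c(1) by (simp add: field_simps)
  let ?L = "(1 / real (Suc n)) *\<^sub>R K"
  have "norm ?L < c" using n by (simp add: pos_divide_less_eq mult.commute del: of_nat_Suc)
  moreover have "?L \<in> off_diagonal p"
    using K subspace_off_diagonal subspace_scale by blast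
  ultimately have "exp ?L \<in> H"
    using c(2) d(2) by simp
  then have "exp ?L ^ Suc n \<in> H" by (rule power_mem)
  then show ?thesis
    unfolding exp_scaleR_of_nat[symmetric] by (simp del: of_nat_Suc)
qed

end

section \<open>Reduction to a corner\<close>

lemma off_diagonalI:
  assumes "projection p" "p * a = 0" "a * p = a"
  shows "a - adj a \<in> off_diagonal p"
proof -
  have "adj p = p" using assms(1) by (simp add: projection_def)
  then have "adj a * p = 0" "p * adj a = adj a"
    using arg_cong[OF assms(2), of adj] arg_cong[OF assms(3), of adj] by (simp_all add: adj_mult)
  then show ?thesis
    using assms(2,3) by (simp add: off_diagonal_def skew_def adj_diff adj_adj algebra_simps flip: scaleR_2)
qed

text \<open>
  The unitaries \<open>(1 - p) + w\<close> with \<open>w\<close> in the corner \<open>p A p\<close>, as far as they are connected to \<open>1\<close> among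
  all unitaries.
\<close>

definition corner_unitaries :: "'a::cstar_algebra \<Rightarrow> 'a set" where
  "corner_unitaries p = {v \<in> unitary_component. v * (1 - p) = 1 - p \<and> (1 - p) * v = 1 - p}"

lemma exp_corner_mem:
  assumes p: "projection p" and y: "skew y" "y * (1 - p) = 0"
  shows "exp y \<in> corner_unitaries p"
proof -
  have right: "exp x * (1 - p) = 1 - p" if "x * (1 - p) = 0" for x
  proof -
    obtain f where "exp x - 1 = f * x" using exp_minus_one_factor by blast
    then have "(exp x - 1) * (1 - p) = f * (x * (1 - p))" by (simp add: mult.assoc)
    then show ?thesis by (simp add: that left_diff_distrib)
  qed
  have "adj (exp (- y) * (1 - p)) = (1 - p) * exp y"
    using p y(1) by (simp add: adj_mult adj_diff projection_def exp_skew_adj skew_minus)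
  moreover have "exp (- y) * (1 - p) = 1 - p"
    using right[of "- y"] y(2) by simp
  moreover have "adj (1 - p) = 1 - p"
    using p by (simp add: adj_diff projection_def)
  ultimately show ?thesis
    using right[OF y(2)] exp_skew_in_unitary_component[OF y(1)] by (simp add: corner_unitaries_def)
qed

lemma corner_unitaries_mult:
  assumes "v \<in> corner_unitaries p" "w \<in> corner_unitaries p"
  shows "v * w \<in> corner_unitaries p"
  using assms unfolding corner_unitaries_def
  by (auto simp: unitary_component_mult mult.assoc) (simp flip: mult.assoc)

lemma corner_unitaries_adj:
  assumes "projection p" "v \<in> corner_unitaries p"
  shows "adj v \<in> corner_unitaries p"
proof -
  have q: "adj (1 - p) = 1 - p"
    using assms(1) by (simp add: adj_diff projection_def)
  have v: "v \<in> unitary_component" "v * (1 - p) = 1 - p" "(1 - p) * v = 1 - p"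
    using assms(2) by (auto simp: corner_unitaries_def)
  have "adj v * (1 - p) = adj ((1 - p) * v)" "(1 - p) * adj v = adj (v * (1 - p))"
    by (simp_all only: adj_mult q)
  then have "adj v * (1 - p) = 1 - p" "(1 - p) * adj v = 1 - p"
    by (simp_all only: v q)
  then show ?thesis
    using unitary_component_adj[OF v(1)] by (simp add: corner_unitaries_def)
qed

text \<open>
  Elements of orthogonal corners multiply to zero in both orders, so \<open>v - 1\<close> and \<open>w - 1\<close> commute.
\<close>

lemma corner_unitaries_commute:
  assumes "projection p" "projection q" "p * q = 0"
    and v: "v \<in> corner_unitaries p" and w: "w \<in> corner_unitaries q"
  shows "v * w = w * v"
proof -
  have qp: "q * p = 0"
    using arg_cong[OF assms(3), of adj] assms(1,2) by (simp add: adj_mult projection_def)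
  have v1: "v - 1 = (v - 1) * p" "v - 1 = p * (v - 1)"
    and w1: "w - 1 = (w - 1) * q" "w - 1 = q * (w - 1)"
    using v w by (auto simp: corner_unitaries_def algebra_simps)
  have "(v - 1) * (w - 1) = (v - 1) * (p * q) * (w - 1)"
    using v1(1) w1(2) by (metis mult.assoc)
  moreover have "(w - 1) * (v - 1) = (w - 1) * (q * p) * (v - 1)"
    using w1(1) v1(2) by (metis mult.assoc)
  ultimately have "(v - 1) * (w - 1) = (w - 1) * (v - 1)"
    by (simp add: assms(3) qp)
  then show ?thesis by (simp add: algebra_simps)
qed

lemma full_projection_dense:
  assumes "full_projection (p :: 'a::cstar_algebra)"
  shows "closure (cspan {a * p * b | a b. True}) = UNIV"
proof -
  let ?X = "{a * p * b | a b. True}" and ?I = "closure (cspan {a * p * b | a b. True})"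
  have sub: "csubspace ?I"
    by (intro csubspace_closure complex_vector.subspace_span)
  have gen: "a * p * b \<in> ?I" for a b
    using complex_vector.span_base[of "a * p * b" ?X] closure_subset by blast
  have "closed_ideal ?I"
    unfolding closed_ideal_def
  proof (intro conjI allI ballI sub)
    fix c x assume x: "x \<in> ?I"
    show "c * x \<in> ?I"
    proof (rule closure_cspan_image_subset[OF bounded_linear_mult_right _ _ sub _ x])
      show "c * y \<in> ?I" if "y \<in> ?X" for y
        using that gen[of "c * _"] by (auto simp: mult.assoc)
    qed (auto simp: mult_scaleC_right)
    show "x * c \<in> ?I"
    proof (rule closure_cspan_image_subset[OF bounded_linear_mult_left _ _ sub _ x])
      show "y * c \<in> ?I" if "y \<in> ?X" for y
        using that gen[of _ "_ * c"] by (auto simp: mult.assoc)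
    qed (auto simp: mult_scaleC_left)
  qed auto
  moreover have "{p} \<subseteq> ?I" using gen[of 1 1] by simp
  ultimately have "closed_ideal_generated {p} \<subseteq> ?I"
    by (intro hull_minimal)
  then show ?thesis using assms by (auto simp: full_projection_def)
qed

lemma tangent_map_conj:
  assumes "tangent_map G D" "\<And>g. g \<in> G \<Longrightarrow> u * g * adj u \<in> G" "u \<in> unitaries"
  shows "tangent_map G (\<lambda>x. u * D x * adj u)"
proof -
  obtain g where g: "strict_deriv g D" "g 0 = 1" "\<And>x. g x \<in> G"
    using assms(1) unfolding tangent_map_def by auto
  have "bounded_linear (\<lambda>x. u * x * adj u)"
    by (intro bounded_linear_mult_const bounded_linear_const_mult bounded_linear_ident)
  from strict_deriv_bounded_linear_compose[OF this g(1)]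
  show ?thesis
    using assms(2,3) g(2,3) by (intro tangent_mapI[where g = "\<lambda>x. u * g x * adj u"]) (auto simp: unitariesD)
qed

lemma approx_tangent_map_mono: "approx_tangent_map G L \<Longrightarrow> G \<subseteq> G' \<Longrightarrow> approx_tangent_map G' L"
  unfolding approx_tangent_map_def tangent_map_def by (meson subsetD)

context normal_unitary_subgroup
begin

text \<open>
  The elements \<open>u exp (B x / t) u\<^sup>* exp (- B x / t)\<close> of \<open>H\<close>, with \<open>u = exp (t K)\<close>, have as derivative the
  difference quotient of the conjugation with \<open>exp (t K)\<close>, applied to \<open>B x\<close>. Letting \<open>t\<close> tend to zero
  gives the bracket.
\<close>

lemma approx_tangent_map_bracket:
  assumes K: "skew K" and B: "bounded_linear B" "\<And>c x. exp (c *\<^sub>R B x) \<in> H"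
  shows "approx_tangent_map H (\<lambda>x. K * B x - B x * K)"
proof (rule approx_tangent_map_limit)
  fix e :: real assume "e > 0"
  obtain k where k: "k > 0" "\<And>x. norm (B x) \<le> norm x * k"
    using bounded_linear.pos_bounded[OF B(1)] by blast
  have "e / k > 0" using k(1) \<open>e > 0\<close> by simp
  then obtain t where t: "t > 0" "\<forall>x. norm ((1/t) *\<^sub>R (exp (t *\<^sub>R K) * x * exp (- (t *\<^sub>R K)) - x) - (K * x - x * K))
      \<le> e / k * norm x"
    using commutator_is_derivative_of_conjugation[OF K] by blast
  define u where "u = exp (t *\<^sub>R K)"
  have u: "u \<in> unitary_component" "adj u = exp (- (t *\<^sub>R K))"
    using K by (simp_all add: u_def exp_skew_in_unitary_component skew_scaleR exp_skew_adj)
  have lin: "bounded_linear (\<lambda>x. c *\<^sub>R B x)" for c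
    by (rule bounded_linear_const_scaleR[OF B(1)])
  have "tangent_map H (\<lambda>x. u * ((1/t) *\<^sub>R B x) * adj u)"
    using u(1) unitary_component_subset
    by (intro tangent_map_conj[OF tangent_map_exp[OF lin B(2)]] conj) auto
  from tangent_map_add[OF mult this tangent_map_exp[OF lin[of "- (1/t)"] B(2)]]
  have "approx_tangent_map H (\<lambda>x. u * ((1/t) *\<^sub>R B x) * adj u + (- (1/t)) *\<^sub>R B x)"
    by (rule tangent_map_imp_approx)
  moreover have "norm (u * ((1/t) *\<^sub>R B x) * adj u + (- (1/t)) *\<^sub>R B x - (K * B x - B x * K)) \<le> e * norm x" for x
  proof -
    have "u * ((1/t) *\<^sub>R B x) * adj u + (- (1/t)) *\<^sub>R B x = (1/t) *\<^sub>R (u * B x * adj u - B x)"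
      by (simp add: scaleR_diff_right)
    then have "norm (u * ((1/t) *\<^sub>R B x) * adj u + (- (1/t)) *\<^sub>R B x - (K * B x - B x * K)) \<le> e / k * norm (B x)"
      using t(2)[rule_format, of "B x"] unfolding u(2)[symmetric] u_def[symmetric] by (simp only:)
    also have "\<dots> \<le> e / k * (norm x * k)"
      using k(1) \<open>e > 0\<close> by (intro mult_left_mono k(2)) auto
    finally show ?thesis using k(1) by simp
  qed
  ultimately show "\<exists>M. approx_tangent_map H M \<and> (\<forall>x. norm (M x - (K * B x - B x * K)) \<le> e * norm x)"
    by blast
qed

text \<open>
  A subgroup, because \<open>H\<close> is normal: the product of \<open>H\<close> and the unitaries of the corner.
\<close>

definition corner_extension :: "'a \<Rightarrow> 'a set" where
  "corner_extension p = {h * v | h v. h \<in> H \<and> v \<in> corner_unitaries p}"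

lemma corner_extension_one: "1 \<in> corner_extension p"
  unfolding corner_extension_def corner_unitaries_def using one
  by (intro CollectI exI[of _ 1]) simp

lemma corner_extension_subset: "H \<subseteq> corner_extension p"
proof
  fix h assume "h \<in> H"
  then show "h \<in> corner_extension p"
    unfolding corner_extension_def corner_unitaries_def
    by (intro CollectI exI[of _ h] exI[of _ 1]) simp
qed

lemma corner_unitaries_subset_extension: "corner_unitaries p \<subseteq> corner_extension p"
proof
  fix v assume "v \<in> corner_unitaries p"
  then show "v \<in> corner_extension p"
    unfolding corner_extension_def using one
    by (intro CollectI exI[of _ 1] exI[of _ v]) simp
qed

lemma corner_extension_mult:
  assumes "g \<in> corner_extension p" "g' \<in> corner_extension p"
  shows "g * g' \<in> corner_extension p"
proof -
  obtain h v h' v' where *: "g = h * v" "h \<in> H" "v \<in> corner_unitaries p"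
      "g' = h' * v'" "h' \<in> H" "v' \<in> corner_unitaries p"
    using assms unfolding corner_extension_def by blast
  have v: "v \<in> unitary_component" using * by (simp add: corner_unitaries_def)
  then have "v \<in> unitaries" using unitary_component_subset by blast
  then have "g * g' = (h * (v * h' * adj v)) * (v * v')"
    by (simp add: * mult.assoc unitary_cancel)
  then show ?thesis
    unfolding corner_extension_def
    using mult[OF *(2) conj[OF v *(5)]] corner_unitaries_mult[OF *(3,6)] by blast
qed

lemma corner_extension_adj:
  assumes "projection p" "g \<in> corner_extension p"
  shows "adj g \<in> corner_extension p"
proof -
  obtain h v where *: "g = h * v" "h \<in> H" "v \<in> corner_unitaries p"
    using assms unfolding corner_extension_def by blast
  have v: "v \<in> unitary_component" using * by (simp add: corner_unitaries_def)
  then have "v \<in> unitaries" using unitary_component_subset by blast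
  then have "adj g = (adj v * adj h * adj (adj v)) * adj v"
    by (simp add: * adj_mult adj_adj mult.assoc unitariesD)
  then show ?thesis
    unfolding corner_extension_def
    using conj[OF unitary_component_adj[OF v] adjoint[OF *(2)]] corner_unitaries_adj[OF assms(1) *(3)]
    by blast
qed

lemma corner_extension_unitary: "corner_extension p \<subseteq> unitaries"
  using unitary unitary_component_subset
  by (auto simp: corner_extension_def corner_unitaries_def intro!: unitaries_mult)

text \<open>
  For \<open>\<alpha>\<close>, \<open>\<beta>\<close> in \<open>(1 - p) A p\<close> the bracket of the off-diagonal elements \<open>\<alpha> - \<alpha>\<^sup>*\<close> and
  \<open>(\<beta> - \<beta>\<^sup>*) / 2\<close> is the skew-adjoint part of \<open>\<beta> \<alpha>\<^sup>*\<close> in the corner of \<open>1 - p\<close>, minus the skew-adjoint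
  part of \<open>\<alpha>\<^sup>* \<beta>\<close> in the corner of \<open>p\<close>. The first is what is wanted, and the second is tangent to
  the unitaries of the corner \<open>p A p\<close>.
\<close>

lemma approx_tangent_map_lower_corner:
  assumes dense: "closure (cspan H) = UNIV" and p: "projection p"
  shows "approx_tangent_map (corner_extension p)
      (\<lambda>x. skew_part ((1 - p) * skew_part x * (a * p * b) * (1 - p)))"
proof -
  have pp: "p * p = p" and ap: "adj p = p" using p by (auto simp: projection_def)
  have ppx: "p * (p * x) = p * x" for x by (simp add: pp flip: mult.assoc)
  define \<alpha> where "\<alpha> = (1 - p) * adj b * p"
  define \<beta> where "\<beta> x = (1 - p) * skew_part x * a * p" for x
  have \<alpha>: "p * \<alpha> = 0" "\<alpha> * p = \<alpha>"
    by (simp_all add: \<alpha>_def algebra_simps pp ppx)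
  have \<beta>: "p * \<beta> x = 0" "\<beta> x * p = \<beta> x" for x
    by (simp_all add: \<beta>_def algebra_simps pp ppx)
  have lin\<beta>: "bounded_linear \<beta>"
    unfolding \<beta>_def
    by (intro bounded_linear_mult_const bounded_linear_const_mult bounded_linear_skew_part)
  define K where "K = \<alpha> - adj \<alpha>"
  define B where "B x = (1/2) *\<^sub>R (\<beta> x - adj (\<beta> x))" for x
  have linB: "bounded_linear B"
    unfolding B_def
    by (intro bounded_linear_const_scaleR bounded_linear_sub lin\<beta>
        bounded_linear_compose[OF bounded_linear_adj lin\<beta>])
  have "B x \<in> off_diagonal p" for x
    unfolding B_def using off_diagonalI[OF p \<beta>] subspace_off_diagonal subspace_scale by blast
  then have expB: "exp (c *\<^sub>R B x) \<in> H" for c x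
    using subspace_off_diagonal subspace_scale by (intro exp_off_diagonal_mem[OF dense p]) blast
  have "skew K"
    using off_diagonalI[OF p \<alpha>] by (simp add: K_def off_diagonal_def)
  from approx_tangent_map_bracket[OF this linB expB]
  have 1: "approx_tangent_map (corner_extension p) (\<lambda>x. K * B x - B x * K)"
    by (rule approx_tangent_map_mono[OF _ corner_extension_subset])
  define C where "C x = skew_part (adj \<alpha> * \<beta> x)" for x
  have "bounded_linear C"
    unfolding C_def by (rule bounded_linear_compose[OF bounded_linear_skew_part
        bounded_linear_const_mult[OF lin\<beta>]])
  moreover have "exp (C x) \<in> corner_extension p" for x
  proof -
    have "adj (\<beta> x) * \<alpha> * (1 - p) = 0" "adj \<alpha> * \<beta> x * (1 - p) = 0"
      using \<alpha> \<beta> by (simp_all add: mult.assoc right_diff_distrib)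
    then have "C x * (1 - p) = 0"
      by (simp add: C_def skew_part_def adj_mult adj_adj left_diff_distrib)
    then show ?thesis
      using exp_corner_mem[OF p, of "C x"] corner_unitaries_subset_extension by (auto simp: C_def)
  qed
  ultimately have 2: "approx_tangent_map (corner_extension p) C"
    by (intro tangent_map_imp_approx tangent_map_exp)
  have "K * B x - B x * K + C x = skew_part ((1 - p) * skew_part x * (a * p * b) * (1 - p))" for x
  proof -
    have *: "y * z = 0" if "y * p = y" "p * z = 0" for y z
      using that by (metis mult.assoc mult_zero_right)
    have zero: "\<alpha> * \<beta> x = 0" "\<beta> x * \<alpha> = 0"
      using * \<alpha> \<beta> by blast+
    then have zero': "adj \<beta>' * adj \<alpha> = 0" "adj \<alpha> * adj \<beta>' = 0" if "\<beta>' = \<beta> x" for \<beta>'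
      using that by (simp_all flip: adj_mult)
    have "K * B x - B x * K = (1/2) *\<^sub>R (\<beta> x * adj \<alpha> - \<alpha> * adj (\<beta> x)) - C x"
      unfolding K_def B_def C_def skew_part_def
      using zero zero'[OF refl] by (simp add: algebra_simps adj_mult adj_adj)
    moreover have "\<beta> x * adj \<alpha> = (1 - p) * skew_part x * (a * p * b) * (1 - p)"
      by (simp add: \<alpha>_def \<beta>_def adj_mult adj_diff adj_adj ap mult.assoc ppx)
    moreover have "adj (\<beta> x * adj \<alpha>) = \<alpha> * adj (\<beta> x)"
      by (simp add: adj_mult adj_adj)
    ultimately show ?thesis by (simp add: skew_part_def)
  qed
  then show ?thesis
    using approx_tangent_map_add[OF corner_extension_mult 1 2] by simp
qed

text \<open>
  A skew-adjoint element is the sum of its two diagonal corners and its off-diagonal part. Fullness of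
  \<open>p\<close> enters for the corner of \<open>1 - p\<close>: elements \<open>a p b\<close> have combinations close to \<open>1\<close>, so inserting
  them in the middle of \<open>(1 - p) x (1 - p)\<close> approximates that corner in operator norm.
\<close>

lemma corner_extension_tangent_skew_part:
  assumes dense: "closure (cspan H) = UNIV" and full: "full_projection p"
  shows "approx_tangent_map (corner_extension p) skew_part"
proof -
  have p: "projection p" using full by (simp add: full_projection_def)
  have pp: "p * p = p" and ap: "adj p = p" using p by (auto simp: projection_def)
  have ppx: "p * (p * x) = p * x" for x by (simp add: pp flip: mult.assoc)
  let ?G = "corner_extension p"
  let ?L = "\<lambda>s x. skew_part ((1 - p) * skew_part x * s * (1 - p))"
  have span: "approx_tangent_map ?G (?L s)" if "s \<in> cspan {a * p * b | a b. True}" for s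
    using that
  proof (induction rule: complex_vector.span_induct_alt)
    case base
    then show ?case
      using tangent_map_imp_approx[OF tangent_map_zero[OF corner_extension_one]] by simp
  next
    case (step c y s)
    then obtain a b where "y = a * p * b" by blast
    then have "c *\<^sub>C y = (c *\<^sub>C a) * p * b" by (simp add: mult_scaleC_left)
    then have "approx_tangent_map ?G (?L (c *\<^sub>C y))"
      using approx_tangent_map_lower_corner[OF dense p, of "c *\<^sub>C a" b] by simp
    from approx_tangent_map_add[OF corner_extension_mult this step.IH]
    show ?case by (simp add: distrib_left distrib_right flip: skew_part_add)
  qed
  have q1: "norm (1 - p) \<le> 2"
  proof -
    have "norm p = (norm p)\<^sup>2" using cstar_identity[of p] by (simp add: pp ap)
    then have "norm p \<le> 1" by (auto simp: power2_eq_square)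
    then show ?thesis using norm_triangle_ineq4[of 1 p] by simp
  qed
  have lower: "approx_tangent_map ?G (?L 1)"
  proof (rule approx_tangent_map_limit)
    fix e :: real assume "e > 0"
    then obtain s where s: "s \<in> cspan {a * p * b | a b. True}" "dist s 1 < e / 4"
      using closure_approachable[of 1 "cspan {a * p * b | a b. True}"] full_projection_dense[OF full]
      by (metis UNIV_I divide_pos_pos zero_less_numeral)
    have "norm (?L s x - ?L 1 x) \<le> e * norm x" for x
    proof -
      have "?L s x - ?L 1 x = skew_part ((1 - p) * skew_part x * (s - 1) * (1 - p))"
        by (simp add: algebra_simps flip: skew_part_diff)
      also have "norm \<dots> \<le> norm ((1 - p) * skew_part x * (s - 1) * (1 - p))"
        by (rule norm_skew_part_le)
      also have "\<dots> \<le> 2 * norm x * (e / 4) * 2"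
        using s(2) q1 norm_skew_part_le[of x] \<open>e > 0\<close>
        by (intro order_trans[OF norm_mult_ineq] mult_mono) (auto simp: dist_norm)
      finally show ?thesis by simp
    qed
    then show "\<exists>M. approx_tangent_map ?G M \<and> (\<forall>x. norm (M x - ?L 1 x) \<le> e * norm x)"
      using span[OF s(1)] by blast
  qed
  define R where "R x = (1 - p) * skew_part x * p" for x
  define P where "P x = p * skew_part x * p" for x
  have linR: "bounded_linear R" and linP: "bounded_linear P"
    unfolding R_def P_def
    by (intro bounded_linear_mult_const bounded_linear_const_mult bounded_linear_skew_part)+
  have "approx_tangent_map ?G (\<lambda>x. R x - adj (R x))"
  proof (intro tangent_map_imp_approx tangent_map_exp)
    show "bounded_linear (\<lambda>x. R x - adj (R x))"
      by (intro bounded_linear_sub linR bounded_linear_compose[OF bounded_linear_adj linR])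
    have "p * R x = 0" "R x * p = R x" for x
      by (simp_all add: R_def algebra_simps pp ppx)
    then show "exp (R x - adj (R x)) \<in> ?G" for x
      using exp_off_diagonal_mem[OF dense p off_diagonalI[OF p]] corner_extension_subset by blast
  qed
  moreover have "approx_tangent_map ?G P"
  proof (intro tangent_map_imp_approx tangent_map_exp linP)
    fix x
    have "skew (P x)"
      using skew_conj[OF skew_skew_part, of p x] by (simp add: P_def ap)
    moreover have "P x * (1 - p) = 0"
      by (simp add: P_def mult.assoc right_diff_distrib pp)
    ultimately show "exp (P x) \<in> ?G"
      using exp_corner_mem[OF p] corner_unitaries_subset_extension by blast
  qed
  ultimately have "approx_tangent_map ?G (\<lambda>x. ?L 1 x + ((R x - adj (R x)) + P x))"
    by (intro approx_tangent_map_add corner_extension_mult lower)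
  moreover have "?L 1 x + ((R x - adj (R x)) + P x) = skew_part x" for x
  proof -
    have sk: "adj (skew_part x) = - skew_part x"
      using skew_skew_part[of x] by (simp add: skew_def)
    have "skew ((1 - p) * skew_part x * adj (1 - p))"
      by (intro skew_conj skew_skew_part)
    then have L1: "?L 1 x = (1 - p) * skew_part x * (1 - p)"
      by (simp add: adj_diff ap)
    have adjR: "adj (R x) = - (p * skew_part x * (1 - p))"
      by (simp add: R_def adj_mult adj_diff ap sk mult.assoc)
    show ?thesis
      unfolding L1 adjR unfolding R_def P_def by (simp add: algebra_simps)
  qed
  ultimately show ?thesis by simp
qed

text \<open>
  The tangent maps of the subgroup include one close to the identity on all skew-adjoint elements, so
  it contains a neighbourhood of \<open>1\<close>.
\<close>

lemma unitary_component_subset_corner_extension: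
  assumes dense: "closure (cspan H) = UNIV" and full: "full_projection p"
  shows "unitary_component \<subseteq> corner_extension p"
proof -
  have p: "projection p" using full by (simp add: full_projection_def)
  obtain D where D: "tangent_map (corner_extension p) D" "\<forall>x. norm (D x - skew_part x) \<le> 1/2 * norm x"
    using corner_extension_tangent_skew_part[OF assms] unfolding approx_tangent_map_def
    by (metis zero_less_divide_1_iff zero_less_numeral)
  obtain g where g: "strict_deriv g D" "g 0 = 1" "\<And>x. g x \<in> corner_extension p"
    using D(1) unfolding tangent_map_def by auto
  have "\<exists>d>0. \<forall>u\<in>unitaries. norm (u - 1) < d \<longrightarrow> skew_part u \<in> {x. skew x} \<longrightarrow> u \<in> range g"
  proof (rule unitaries_near_one_in_range[OF g(1,2)])
    show "g x \<in> unitaries" for x using g(3) corner_extension_unitary by blast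
    show "closed {x :: 'a. skew x}"
      unfolding skew_def
      by (intro closed_Collect_eq continuous_intros linear_continuous_on bounded_linear_adj)
    show "subspace {x :: 'a. skew x}"
      by (rule subspaceI) (auto simp: skew_add skew_scaleR, simp add: skew_def)
    show "norm (D v - v) \<le> norm v / 2" if "v \<in> {x. skew x}" for v
      using D(2)[rule_format, of v] that by simp
  qed auto
  then obtain d where d: "d > 0" "\<forall>u\<in>unitaries. norm (u - 1) < d \<longrightarrow> u \<in> range g"
    by auto
  show ?thesis
  proof (rule unitary_component_subset_if_nhds_one[OF corner_extension_one corner_extension_mult
        corner_extension_adj[OF p] corner_extension_unitary d(1)])
    show "u \<in> corner_extension p" if "u \<in> unitaries" "norm (u - 1) < d" for u
      using d(2) g(3) that by auto
  qed
qed

text \<open>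
  Modulo \<open>H\<close>, the unitary \<open>u\<close> lies in the corner of \<open>p\<close> and \<open>w\<close> in the corner of \<open>q\<close>, and these corners
  commute.
\<close>

lemma commutator_mem:
  fixes p q u w :: 'a
  assumes dense: "closure (cspan H) = UNIV"
    and pq: "full_projection p" "full_projection q" "p * q = 0"
    and u: "u \<in> unitary_component" and w: "w \<in> unitary_component"
  shows "u * w * adj u * adj w \<in> H"
proof -
  obtain h v where hv: "u = h * v" "h \<in> H" "v \<in> corner_unitaries p"
    using u unitary_component_subset_corner_extension[OF dense pq(1)] unfolding corner_extension_def by blast
  obtain h' v' where hv': "w = h' * v'" "h' \<in> H" "v' \<in> corner_unitaries q"
    using w unitary_component_subset_corner_extension[OF dense pq(2)] unfolding corner_extension_def by blast
  have comm: "v * v' = v' * v"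
    using corner_unitaries_commute[OF _ _ pq(3) hv(3) hv'(3)] pq(1,2) by (simp add: full_projection_def)
  have v: "v \<in> unitary_component" "v' \<in> unitary_component"
    using hv(3) hv'(3) by (auto simp: corner_unitaries_def)
  then have vu: "v \<in> unitaries" using unitary_component_subset by blast
  have "v' * adj v = adj v * (v * v') * adj v"
    by (simp add: mult.assoc unitary_cancel[OF vu])
  also have "\<dots> = adj v * v'"
    unfolding comm by (simp add: mult.assoc unitariesD[OF vu])
  finally have "v' * (adj v * x) = adj v * (v' * x)" for x
    by (simp flip: mult.assoc)
  then have "u * w * adj u * adj w = h * (v * h' * adj v) * (v' * adj h * adj v') * adj h'"
    by (simp add: hv hv' adj_mult mult.assoc unitary_cancel[OF vu])
  also have "\<dots> \<in> H"
    by (intro mult conj adjoint v hv(2) hv'(2))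
  finally show ?thesis .
qed

end

section \<open>The commutator subgroup\<close>

lemma normal_unitary_subgroupI:
  fixes H :: "'a::cstar_algebra set"
  assumes "H \<lhd> U_group"
  shows "normal_unitary_subgroup H"
proof
  have S: "subgroup H U_group" by (rule normal_imp_subgroup[OF assms])
  show H: "H \<subseteq> unitary_component" using subgroup.subset[OF S] by (simp add: U_group_def)
  show "1 \<in> H" using subgroup.one_closed[OF S] by (simp add: U_group_def)
  show "g * h \<in> H" if "g \<in> H" "h \<in> H" for g h
    using subgroup.m_closed[OF S that] by (simp add: U_group_def)
  show "adj h \<in> H" if "h \<in> H" for h
    using subgroup.m_inv_closed[OF S that] H that by (simp add: inv_U_group subset_iff)
  show "u * h * adj u \<in> H" if "u \<in> unitary_component" "h \<in> H" for u h
    using normal.inv_op_closed2[OF assms, of u h] that inv_U_group[OF that(1)] by (simp add: U_group_def)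
qed

theorem theorem6p3:
  fixes H :: "'a::cstar_algebra set"
  assumes "\<exists>p q :: 'a. full_projection p \<and> full_projection q \<and> p * q = 0"
    and "H \<lhd> U_group"
    and "closed_ideal_generated (commutator_span H unitary_component) = UNIV"
  shows "derived U_group unitary_component \<subseteq> H"
proof -
  interpret H: normal_unitary_subgroup H
    using assms(2) by (rule normal_unitary_subgroupI)
  obtain p q :: 'a where pq: "full_projection p" "full_projection q" "p * q = 0"
    using assms(1) by blast
  have dense: "closure (cspan H) = UNIV"
    by (rule H.closure_cspan_eq_UNIV[OF assms(3)])
  have "u \<otimes>\<^bsub>U_group\<^esub> w \<otimes>\<^bsub>U_group\<^esub> inv\<^bsub>U_group\<^esub> u \<otimes>\<^bsub>U_group\<^esub> inv\<^bsub>U_group\<^esub> w \<in> H"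
    if "u \<in> unitary_component" "w \<in> unitary_component" for u w
    using H.commutator_mem[OF dense pq that] that by (simp add: inv_U_group) (simp add: U_group_def)
  then have "derived_set U_group unitary_component \<subseteq> H" by blast
  then show ?thesis
    unfolding derived_def
    by (rule group.generate_subgroup_incl[OF group_U_group _ normal_imp_subgroup[OF assms(2)]])
qed

end
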